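(* The holomorph $\mathrm{Hol}(F_2)$ of the free group $F_2$ of rank $2$ has a faithful linear representation over a field of characteristic zero; that is, there exist a field $K$ of characteristic zero, a positive integer $d$ and an injective homomorphism $\mathrm{Hol}(F_2) \to \mathrm{GL}_d(K)$.
   Context: The holomorph of a group $G$ is the semidirect product $\mathrm{Hol}(G) = \mathrm{Aut}(G) \ltimes G$ with respect to the natural action of $\mathrm{Aut}(G)$ on $G$. *)

theory Defs
  imports "HOL-Algebra.Bij" "HOL-Algebra.Ring" "Jordan_Normal_Form.Matrix"
begin

text \<open>A letter \<open>(x, True)\<close> stands for the generator \<open>x\<close>, and \<open>(x, False)\<close> for its formal inverse.
  The elements of the free group on \<open>X\<close> are the reduced words over these letters; the product is
  concatenation followed by free reduction.\<close>

type_synonym 'a letter = "'a \<times> bool"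

definition flip :: "'a letter \<Rightarrow> 'a letter" where
  "flip a = (fst a, \<not> snd a)"

definition reduced :: "'a letter list \<Rightarrow> bool" where
  "reduced w \<longleftrightarrow> successively (\<lambda>a b. b \<noteq> flip a) w"

text \<open>Left multiplication of a reduced word by a single letter.\<close>

fun push :: "'a letter \<Rightarrow> 'a letter list \<Rightarrow> 'a letter list" where
  "push a [] = [a]"
| "push a (b # w) = (if b = flip a then w else a # b # w)"

definition free_group :: "'a set \<Rightarrow> 'a letter list monoid" where
  "free_group X =
    \<lparr>carrier = {w \<in> lists (X \<times> UNIV). reduced w},
     monoid.mult = foldr push,
     one = []\<rparr>"

lemma flip_flip [simp]: "flip (flip a) = a"
  by (simp add: flip_def)

lemma fst_flip [simp]: "fst (flip a) = fst a"
  by (simp add: flip_def)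

lemma flip_eq_iff: "flip a = b \<longleftrightarrow> a = flip b"
  by (metis flip_flip)

lemma flip_neq [simp]: "flip a \<noteq> a"
  by (metis flip_def snd_conv)

lemma reduced_Nil [simp]: "reduced []"
  by (simp add: reduced_def)

lemma reduced_Cons:
  "reduced (a # w) \<longleftrightarrow> reduced w \<and> (w = [] \<or> hd w \<noteq> flip a)"
  by (auto simp: reduced_def successively_Cons)

lemma reduced_push: "reduced w \<Longrightarrow> reduced (push a w)"
  by (cases w) (auto simp: reduced_Cons)

lemma lists_push:
  "a \<in> X \<times> UNIV \<Longrightarrow> w \<in> lists (X \<times> UNIV) \<Longrightarrow> push a w \<in> lists (X \<times> UNIV)"
  by (cases w) auto

lemma push_push_flip: "reduced w \<Longrightarrow> push a (push (flip a) w) = w"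
  by (cases w; cases "tl w") (auto simp: reduced_Cons)

lemma reduced_foldr_push: "reduced v \<Longrightarrow> reduced (foldr push u v)"
  by (induction u) (auto intro: reduced_push)

lemma lists_foldr_push:
  "u \<in> lists (X \<times> UNIV) \<Longrightarrow> v \<in> lists (X \<times> UNIV) \<Longrightarrow> foldr push u v \<in> lists (X \<times> UNIV)"
  by (induction u) (simp_all add: lists_push del: in_lists_conv_set mem_Times_iff)

lemma foldr_push_push:
  assumes "reduced v"
  shows "foldr push (push a u) v = push a (foldr push u v)"
  using push_push_flip[OF reduced_foldr_push[OF assms], of a] by (cases u) auto

lemma foldr_push_assoc:
  "reduced w \<Longrightarrow> foldr push (foldr push u v) w = foldr push u (foldr push v w)"
  by (induction u) (auto simp: foldr_push_push)

lemma foldr_push_Nil: "reduced u \<Longrightarrow> foldr push u [] = u"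
proof (induction u)
  case (Cons a u)
  then show ?case by (cases u) (auto simp: reduced_Cons)
qed simp

lemma foldr_push_inverse: "foldr push (rev (map flip u)) u = []"
  by (induction u) auto

lemma reduced_inverse: "reduced u \<Longrightarrow> reduced (rev (map flip u))"
  unfolding reduced_def successively_rev successively_map
  by (erule successively_mono) (metis flip_flip)

theorem group_free_group: "group (free_group X)"
proof (rule groupI)
  fix u assume u: "u \<in> carrier (free_group X)"
  then have "rev (map flip u) \<in> carrier (free_group X)"
    by (auto simp: free_group_def reduced_inverse) (metis fst_conv fst_flip mem_Times_iff subsetD)
  then show "\<exists>y\<in>carrier (free_group X). y \<otimes>\<^bsub>free_group X\<^esub> u = \<one>\<^bsub>free_group X\<^esub>"
    by (rule bexI[rotated]) (simp add: free_group_def foldr_push_inverse)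
qed (simp_all add: free_group_def foldr_push_assoc reduced_foldr_push lists_foldr_push
       del: in_lists_conv_set)

definition letter_val :: "('g, 'b) monoid_scheme \<Rightarrow> ('a \<Rightarrow> 'g) \<Rightarrow> 'a letter \<Rightarrow> 'g" where
  "letter_val G f a = (if snd a then f (fst a) else m_inv G (f (fst a)))"

definition word_val :: "('g, 'b) monoid_scheme \<Rightarrow> ('a \<Rightarrow> 'g) \<Rightarrow> 'a letter list \<Rightarrow> 'g" where
  "word_val G f w = foldr (\<lambda>a g. letter_val G f a \<otimes>\<^bsub>G\<^esub> g) w \<one>\<^bsub>G\<^esub>"

context group
begin

lemma letter_val_closed:
  "f \<in> X \<rightarrow> carrier G \<Longrightarrow> a \<in> X \<times> UNIV \<Longrightarrow> letter_val G f a \<in> carrier G"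
  by (auto simp: letter_val_def)

lemma word_val_closed:
  "f \<in> X \<rightarrow> carrier G \<Longrightarrow> w \<in> lists (X \<times> UNIV) \<Longrightarrow> word_val G f w \<in> carrier G"
  by (induction w)
     (auto simp: word_val_def letter_val_closed simp del: in_lists_conv_set split_paired_All)

lemma word_val_push:
  assumes f: "f \<in> X \<rightarrow> carrier G" and a: "a \<in> X \<times> UNIV" and w: "w \<in> lists (X \<times> UNIV)"
  shows "word_val G f (push a w) = letter_val G f a \<otimes> word_val G f w"
proof (cases "\<exists>v. w = flip a # v")
  case True
  then obtain v where v: "w = flip a # v" by blast
  then have cl: "word_val G f v \<in> carrier G" "f (fst a) \<in> carrier G"
    using word_val_closed[OF f, of v] w f a by auto
  then show ?thesis
    using v by (auto simp: word_val_def letter_val_def flip_def m_assoc[symmetric])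
next
  case False
  then show ?thesis by (cases w) (auto simp: word_val_def)
qed

lemma word_val_hom:
  assumes f: "f \<in> X \<rightarrow> carrier G"
  shows "word_val G f \<in> hom (free_group X) G"
proof (rule homI)
  fix u v assume "u \<in> carrier (free_group X)" "v \<in> carrier (free_group X)"
  then have uv: "u \<in> lists (X \<times> UNIV)" "v \<in> lists (X \<times> UNIV)"
    by (auto simp: free_group_def)
  from uv(1) have "word_val G f (foldr push u v) = word_val G f u \<otimes> word_val G f v"
  proof (induction u)
    case Nil
    then show ?case using word_val_closed[OF f uv(2)] by (simp add: word_val_def)
  next
    case (Cons a u)
    then show ?case
      using word_val_push[OF f Cons.hyps(1) lists_foldr_push[OF Cons.hyps(2) uv(2)]]
        word_val_closed[OF f uv(2)] word_val_closed[OF f Cons.hyps(2)]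
        letter_val_closed[OF f Cons.hyps(1)]
      by (simp add: word_val_def m_assoc)
  qed
  then show "word_val G f (u \<otimes>\<^bsub>free_group X\<^esub> v) = word_val G f u \<otimes> word_val G f v"
    by (simp add: free_group_def)
qed (use word_val_closed[OF f] in \<open>auto simp: free_group_def\<close>)

lemma hom_free_group_eq_word_val:
  assumes h: "h \<in> hom (free_group X) G" and hf: "\<And>x. x \<in> X \<Longrightarrow> h [(x, True)] = f x"
    and w: "w \<in> carrier (free_group X)"
  shows "h w = word_val G f w"
proof -
  interpret F: group "free_group X" by (rule group_free_group)
  have letter: "h [a] = letter_val G f a" if aX: "a \<in> X \<times> UNIV" for a
  proof (cases "snd a")
    case True
    then show ?thesis using hf aX by (cases a) (auto simp: letter_val_def)
  next
    case False
    then obtain x where a: "a = (x, False)" "x \<in> X" using aX by (cases a) simp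
    have cl: "[(x, True)] \<in> carrier (free_group X)" "[a] \<in> carrier (free_group X)"
      using a by (auto simp: free_group_def reduced_Cons)
    have "[a] \<otimes>\<^bsub>free_group X\<^esub> [(x, True)] = \<one>\<^bsub>free_group X\<^esub>"
      by (simp add: free_group_def a flip_def)
    then have "h [a] \<otimes> h [(x, True)] = \<one>"
      using h cl by (metis hom_mult hom_one F.is_group is_group)
    then have "h [a] = m_inv G (h [(x, True)])"
      using h cl by (simp add: hom_in_carrier inv_equality)
    then show ?thesis using hf a by (simp add: letter_val_def)
  qed
  have "w \<in> lists (X \<times> UNIV)" "reduced w" using w by (auto simp: free_group_def)
  then show ?thesis
  proof (induction w)
    case Nil
    then show ?case using hom_one[OF h F.is_group is_group]
      by (simp add: word_val_def free_group_def)
  next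
    case (Cons a w)
    then have cl: "[a] \<in> carrier (free_group X)" "w \<in> carrier (free_group X)"
      by (auto simp: free_group_def reduced_Cons)
    have "a # w = [a] \<otimes>\<^bsub>free_group X\<^esub> w"
      using Cons.prems by (cases w) (auto simp: free_group_def reduced_Cons)
    then have "h (a # w) = h [a] \<otimes> h w"
      using hom_mult[OF h cl] by simp
    then show ?case using Cons by (simp add: letter word_val_def reduced_Cons)
  qed
qed

theorem free_group_universal:
  assumes f: "f \<in> X \<rightarrow> carrier G"
  shows "\<exists>h \<in> hom (free_group X) G. (\<forall>x\<in>X. h [(x, True)] = f x) \<and>
    (\<forall>h' \<in> hom (free_group X) G. (\<forall>x\<in>X. h' [(x, True)] = f x) \<longrightarrow>
      (\<forall>w \<in> carrier (free_group X). h' w = h w))"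
proof (intro bexI[OF _ word_val_hom[OF f]] conjI ballI impI)
  fix x assume "x \<in> X"
  then show "word_val G f [(x, True)] = f x"
    using f by (simp add: word_val_def letter_val_def Pi_def)
qed (auto intro: hom_free_group_eq_word_val)

end

abbreviation F2 :: "nat letter list monoid" where
  "F2 \<equiv> free_group {..<2}"

text \<open>For a left action of \<open>H\<close> on \<open>N\<close> by automorphisms, the pair \<open>(a, x)\<close> represents \<open>x a\<close>
  with \<open>x\<close> in \<open>N\<close> and \<open>a\<close> in \<open>H\<close>, so that \<open>a x a\<^sup>-\<^sup>1\<close> is \<open>act a x\<close>.\<close>

definition semidirect ::
  "('h, 'b) monoid_scheme \<Rightarrow> ('n, 'c) monoid_scheme \<Rightarrow> ('h \<Rightarrow> 'n \<Rightarrow> 'n) \<Rightarrow> ('h \<times> 'n) monoid" where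
  "semidirect H N act =
    \<lparr>carrier = carrier H \<times> carrier N,
     monoid.mult = \<lambda>(a, x) (b, y). (a \<otimes>\<^bsub>H\<^esub> b, x \<otimes>\<^bsub>N\<^esub> act a y),
     one = (\<one>\<^bsub>H\<^esub>, \<one>\<^bsub>N\<^esub>)\<rparr>"

definition holomorph :: "('a, 'b) monoid_scheme \<Rightarrow> (('a \<Rightarrow> 'a) \<times> 'a) monoid" where
  "holomorph G = semidirect (AutoGroup G) G (\<lambda>a x. a x)"

lemma group_semidirect:
  assumes "group H" "group N" and act: "act \<in> hom H (BijGroup (carrier N))"
    and act_hom: "\<And>a. a \<in> carrier H \<Longrightarrow> act a \<in> hom N N"
  shows "group (semidirect H N act)"
proof -
  interpret H: group H by fact
  interpret N: group N by fact
  have bij: "act a \<in> Bij (carrier N)" if "a \<in> carrier H" for a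
    using hom_in_carrier[OF act that] by (simp add: BijGroup_def)
  have act_closed [simp]: "act a x \<in> carrier N" if "a \<in> carrier H" "x \<in> carrier N" for a x
    using Bij_imp_funcset[OF bij] that by blast
  have act_mult: "act (a \<otimes>\<^bsub>H\<^esub> b) x = act a (act b x)"
    if "a \<in> carrier H" "b \<in> carrier H" "x \<in> carrier N" for a b x
    using hom_mult[OF act that(1,2)] bij that by (simp add: BijGroup_def compose_def)
  have act_one: "act \<one>\<^bsub>H\<^esub> x = x" if "x \<in> carrier N" for x
    using hom_one[OF act H.is_group group_BijGroup] that by (simp add: BijGroup_def)
  have act_distrib: "act a (x \<otimes>\<^bsub>N\<^esub> y) = act a x \<otimes>\<^bsub>N\<^esub> act a y"
    if "a \<in> carrier H" "x \<in> carrier N" "y \<in> carrier N" for a x y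
    using act_hom that by (simp add: hom_mult)
  show ?thesis
  proof (rule groupI)
    fix p assume "p \<in> carrier (semidirect H N act)"
    then obtain a x where p: "p = (a, x)" "a \<in> carrier H" "x \<in> carrier N"
      by (auto simp: semidirect_def)
    let ?b = "m_inv H a"
    let ?q = "(?b, m_inv N (act ?b x))"
    have "?q \<in> carrier (semidirect H N act)"
      using p by (simp add: semidirect_def)
    moreover have "?q \<otimes>\<^bsub>semidirect H N act\<^esub> p = \<one>\<^bsub>semidirect H N act\<^esub>"
      using p by (simp add: semidirect_def)
    ultimately show "\<exists>q\<in>carrier (semidirect H N act).
        q \<otimes>\<^bsub>semidirect H N act\<^esub> p = \<one>\<^bsub>semidirect H N act\<^esub>" by blast
  qed (auto simp: semidirect_def H.m_assoc N.m_assoc act_mult act_one act_distrib)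
qed

theorem group_holomorph:
  assumes "group G"
  shows "group (holomorph G)"
  unfolding holomorph_def
proof (rule group_semidirect)
  show "group (AutoGroup G)" by (rule group.AutoGroup[OF assms])
  show "(\<lambda>a. a) \<in> hom (AutoGroup G) (BijGroup (carrier G))"
    by (auto simp: hom_def AutoGroup_def auto_def BijGroup_def)
qed (use assms in \<open>auto simp: AutoGroup_def auto_def\<close>)

text \<open>The field is an explicit structure \<open>K\<close>: both its carrier, a subset of the type \<open>'k\<close>, and
  its operations are arbitrary, and need not be those of a type class instance. Quantifying over all
  \<open>K :: complex ring\<close> that are fields therefore covers, up to isomorphism, all fields of cardinality
  at most that of the continuum. For a representation of a countable group this is no restriction,
  since the matrix entries of the image generate a countable subfield.\<close>

definition matrix_monoid :: "('k, 'b) ring_scheme \<Rightarrow> nat \<Rightarrow> 'k mat monoid" where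
  "matrix_monoid K d =
    \<lparr>carrier = {A \<in> carrier_mat d d. elements_mat A \<subseteq> carrier K},
     monoid.mult = \<lambda>A B. mat d d (\<lambda>(i, j). \<Oplus>\<^bsub>K\<^esub>k\<in>{..<d}. A $$ (i, k) \<otimes>\<^bsub>K\<^esub> B $$ (k, j)),
     one = mat d d (\<lambda>(i, j). if i = j then \<one>\<^bsub>K\<^esub> else \<zero>\<^bsub>K\<^esub>)\<rparr>"

definition GL :: "nat \<Rightarrow> ('k, 'b) ring_scheme \<Rightarrow> 'k mat monoid" where
  "GL d K = units_of (matrix_monoid K d)"

definition char_zero :: "('k, 'b) ring_scheme \<Rightarrow> bool" where
  "char_zero K \<longleftrightarrow> (\<forall>n::nat. n > 0 \<longrightarrow> [n] \<cdot>\<^bsub>K\<^esub> \<one>\<^bsub>K\<^esub> \<noteq> \<zero>\<^bsub>K\<^esub>)"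

lemma matrix_monoid_entry:
  "A \<in> carrier (matrix_monoid K d) \<Longrightarrow> i < d \<Longrightarrow> j < d \<Longrightarrow> A $$ (i, j) \<in> carrier K"
  by (auto simp: matrix_monoid_def intro: elements_matI)

lemma mat_in_matrix_monoid:
  "(\<And>i j. i < d \<Longrightarrow> j < d \<Longrightarrow> f (i, j) \<in> carrier K) \<Longrightarrow> mat d d f \<in> carrier (matrix_monoid K d)"
  by (auto simp: matrix_monoid_def dest!: elements_matD)

lemma (in cring) finsum_swap_lessThan:
  assumes "\<And>i j. i < n \<Longrightarrow> j < m \<Longrightarrow> f i j \<in> carrier R"
  shows "(\<Oplus>i\<in>{..<n::nat}. \<Oplus>j\<in>{..<m::nat}. f i j) = (\<Oplus>j\<in>{..<m}. \<Oplus>i\<in>{..<n}. f i j)"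
  using assms
proof (induction n)
  case (Suc n)
  then have "(\<Oplus>i\<in>{..<Suc n}. \<Oplus>j\<in>{..<m}. f i j)
      = (\<Oplus>j\<in>{..<m}. f n j) \<oplus> (\<Oplus>j\<in>{..<m}. \<Oplus>i\<in>{..<n}. f i j)"
    by (simp add: lessThan_Suc Pi_def)
  also have "\<dots> = (\<Oplus>j\<in>{..<m}. f n j \<oplus> (\<Oplus>i\<in>{..<n}. f i j))"
    using Suc.prems by (subst finsum_addf) (auto intro!: finsum_closed)
  also have "\<dots> = (\<Oplus>j\<in>{..<m}. \<Oplus>i\<in>{..<Suc n}. f i j)"
    using Suc.prems by (intro finsum_cong') (auto simp: lessThan_Suc Pi_def intro!: finsum_closed)
  finally show ?case .
qed simp

theorem (in cring) monoid_matrix_monoid: "monoid (matrix_monoid R d)"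
proof (rule monoidI)
  fix A B C
  assume A: "A \<in> carrier (matrix_monoid R d)" and B: "B \<in> carrier (matrix_monoid R d)"
  note eA = matrix_monoid_entry[OF A] and eB = matrix_monoid_entry[OF B]
  show "A \<otimes>\<^bsub>matrix_monoid R d\<^esub> B \<in> carrier (matrix_monoid R d)"
    unfolding matrix_monoid_def[of R d, THEN arg_cong[where f = monoid.mult], simplified]
    by (rule mat_in_matrix_monoid) (auto intro!: finsum_closed eA eB)
  assume C: "C \<in> carrier (matrix_monoid R d)"
  note eC = matrix_monoid_entry[OF C]
  have "(\<Oplus>k\<in>{..<d}. (\<Oplus>l\<in>{..<d}. A $$ (i, l) \<otimes> B $$ (l, k)) \<otimes> C $$ (k, j))
      = (\<Oplus>l\<in>{..<d}. A $$ (i, l) \<otimes> (\<Oplus>k\<in>{..<d}. B $$ (l, k) \<otimes> C $$ (k, j)))"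
    if ij: "i < d" "j < d" for i j
  proof -
    have "(\<Oplus>k\<in>{..<d}. (\<Oplus>l\<in>{..<d}. A $$ (i, l) \<otimes> B $$ (l, k)) \<otimes> C $$ (k, j))
        = (\<Oplus>k\<in>{..<d}. \<Oplus>l\<in>{..<d}. A $$ (i, l) \<otimes> B $$ (l, k) \<otimes> C $$ (k, j))"
      using ij by (intro finsum_cong') (auto intro!: finsum_closed finsum_ldistr simp: eA eB eC)
    also have "\<dots> = (\<Oplus>l\<in>{..<d}. \<Oplus>k\<in>{..<d}. A $$ (i, l) \<otimes> B $$ (l, k) \<otimes> C $$ (k, j))"
      using ij by (intro finsum_swap_lessThan) (simp add: eA eB eC)
    also have "\<dots> = (\<Oplus>l\<in>{..<d}. \<Oplus>k\<in>{..<d}. A $$ (i, l) \<otimes> (B $$ (l, k) \<otimes> C $$ (k, j)))"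
      using ij by (intro finsum_cong' refl) (auto intro!: finsum_closed simp: eA eB eC m_assoc)
    also have "\<dots> = (\<Oplus>l\<in>{..<d}. A $$ (i, l) \<otimes> (\<Oplus>k\<in>{..<d}. B $$ (l, k) \<otimes> C $$ (k, j)))"
      using ij by (intro finsum_cong' finsum_rdistr[symmetric] refl)
        (auto intro!: finsum_closed simp: eA eB eC)
    finally show ?thesis .
  qed
  then show "A \<otimes>\<^bsub>matrix_monoid R d\<^esub> B \<otimes>\<^bsub>matrix_monoid R d\<^esub> C
      = A \<otimes>\<^bsub>matrix_monoid R d\<^esub> (B \<otimes>\<^bsub>matrix_monoid R d\<^esub> C)"
    using eA eB eC by (auto simp: matrix_monoid_def intro!: eq_matI cong: finsum_cong)
next
  show "\<one>\<^bsub>matrix_monoid R d\<^esub> \<in> carrier (matrix_monoid R d)"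
    using mat_in_matrix_monoid[of d "\<lambda>(i, j). if i = j then \<one> else \<zero>" R]
    by (auto simp: matrix_monoid_def)
next
  fix A assume A: "A \<in> carrier (matrix_monoid R d)"
  note eA = matrix_monoid_entry[OF A]
  have dim: "dim_row A = d" "dim_col A = d" using A by (auto simp: matrix_monoid_def)
  have l: "(\<Oplus>k\<in>{..<d}. (if i = k then \<one> else \<zero>) \<otimes> A $$ (k, j)) = A $$ (i, j)"
    if "i < d" "j < d" for i j
  proof -
    have "(\<Oplus>k\<in>{..<d}. (if i = k then \<one> else \<zero>) \<otimes> A $$ (k, j))
        = (\<Oplus>k\<in>{..<d}. if i = k then A $$ (k, j) else \<zero>)"
      using that by (intro finsum_cong') (auto simp: eA)
    then show ?thesis using that by (simp add: add.finprod_singleton eA)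
  qed
  have r: "(\<Oplus>k\<in>{..<d}. A $$ (i, k) \<otimes> (if k = j then \<one> else \<zero>)) = A $$ (i, j)"
    if "i < d" "j < d" for i j
  proof -
    have "(\<Oplus>k\<in>{..<d}. A $$ (i, k) \<otimes> (if k = j then \<one> else \<zero>))
        = (\<Oplus>k\<in>{..<d}. if j = k then A $$ (i, k) else \<zero>)"
      using that by (intro finsum_cong') (auto simp: eA)
    then show ?thesis using that by (simp add: add.finprod_singleton eA)
  qed
  show "\<one>\<^bsub>matrix_monoid R d\<^esub> \<otimes>\<^bsub>matrix_monoid R d\<^esub> A = A"
    by (rule eq_matI) (use l dim in \<open>auto simp: matrix_monoid_def eA cong: finsum_cong\<close>)
  show "A \<otimes>\<^bsub>matrix_monoid R d\<^esub> \<one>\<^bsub>matrix_monoid R d\<^esub> = A"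
    by (rule eq_matI) (use r dim in \<open>auto simp: matrix_monoid_def eA cong: finsum_cong\<close>)
qed

theorem (in cring) group_GL: "group (GL d R)"
  unfolding GL_def by (rule monoid.units_group[OF monoid_matrix_monoid])

end

theory Submission
  imports "HOL-Analysis.Analysis" "HOL-Algebra.Generated_Groups" Defs
begin

text \<open>The holomorph acts faithfully on \<open>F\<^sub>2\<close> by \<open>(\<phi>, g) \<cdot> h = g \<phi>(h)\<close>. If \<open>f\<close> maps \<open>F\<^sub>2\<close>
  injectively into a finite-dimensional space such that every element of the holomorph moves the points
  \<open>f h\<close> by some linear map, then these maps restrict to a faithful representation on the span of the
  image of \<open>f\<close>.

  Such an \<open>f\<close> comes from the braid group \<open>B\<^sub>4\<close>, in which \<open>\<sigma>\<^sub>1 \<sigma>\<^sub>3\<^sup>-\<^sup>1\<close> and its conjugate by \<open>\<sigma>\<^sub>2\<close>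
  freely generate a normal subgroup; let \<open>r\<close> be the restriction to it of the Lawrence--Krammer
  representation. Conjugation by braids realizes the automorphisms of \<open>F\<^sub>2\<close> of determinant one, so with
  \<open>\<tau>\<close> inverting the first generator, \<open>f h = (r h, r (\<tau> h))\<close> is as required, because by Nielsen's
  theorem these automorphisms and \<open>\<tau>\<close> generate \<open>Aut F\<^sub>2\<close>. A braid in the kernel of the
  Lawrence--Krammer representation acts trivially on \<open>F\<^sub>2\<close>, and \<open>F\<^sub>2\<close> has trivial centre, so \<open>r\<close> is
  injective.\<close>

section \<open>Cancellation in free groups\<close>

text \<open>Sandwiching a matrix between fixed matrices is linear, so an automorphism induced by
  conjugation with a braid acts linearly on \<open>r h\<close>. Braids give only determinant one,
  which excludes \<tau>. But \<tau> is an involution that normalizes the group of these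
  automorphisms: it turns the chosen moves into their inverses. So both coordinates of
  \<open>f h\<close> transform linearly under braids, and \<tau> merely exchanges them.

  The braid group itself is never constructed. Faithfulness is proved for positive words only, using
  two values of the Krammer parameter: at a transcendental value the matrices are invertible and
  determine their integral polynomial entries; at 0 they are nonnegative, and vanishing coordinates
  show which generators divide a word. Multiplication by a power of the central full twist makes
  every element positive. For the injectivity of \<open>r\<close>, the role of
  \<open>B\<^sub>4\<close> is played by a subgroup of the direct product of the matrix group with
  \<open>Aut F\<^sub>2\<close>, in which \<open>h\<close> corresponds to \<open>r h\<close> paired
  with the inner automorphism of \<open>h\<close>.\<close>

definition inv_word :: "'a letter list \<Rightarrow> 'a letter list" where
  "inv_word w = rev (map flip w)"

lemma inv_word_simps [simp]:
  "inv_word [] = []" "inv_word (u @ v) = inv_word v @ inv_word u" "inv_word (inv_word w) = w"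
  "length (inv_word w) = length w" "inv_word w = [] \<longleftrightarrow> w = []"
  by (simp_all add: inv_word_def rev_map comp_def)

lemma inv_word_Cons: "inv_word (a # w) = inv_word w @ [flip a]"
  by (simp add: inv_word_def)

lemma inv_word_eq_iff [simp]: "inv_word u = inv_word v \<longleftrightarrow> u = v"
  by (metis inv_word_simps(3))

lemma reduced_append:
  "reduced (u @ v) \<longleftrightarrow> reduced u \<and> reduced v \<and> (u = [] \<or> v = [] \<or> hd v \<noteq> flip (last u))"
  by (auto simp: reduced_def successively_append_iff)

lemma reduced_inv_word: "reduced u \<Longrightarrow> reduced (inv_word u)"
  unfolding inv_word_def by (rule reduced_inverse)

lemma not_reduced_inv_word_append:
  assumes "u \<noteq> []" shows "\<not> reduced (inv_word u @ u)"
proof -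
  have "last (inv_word u) = flip (hd u)"
    using assms by (cases u) (simp_all add: inv_word_Cons)
  then show ?thesis using assms by (auto simp: reduced_append)
qed

text \<open>Free groups have no involutions: in even length the word would be the inverse of its
  second half followed by that half, which cancels in the middle; in odd length the middle letter
  would be its own inverse.\<close>

lemma reduced_eq_inv_word: "reduced m \<Longrightarrow> m = inv_word m \<Longrightarrow> m = []"
proof -
  assume red: "reduced m" and eq: "m = inv_word m"
  define k where "k = length m div 2"
  have tk: "take k m = inv_word (drop (length m - k) m)"
    using arg_cong[OF eq, of "take k"] by (simp add: inv_word_def take_rev flip: drop_map)
  show "m = []"
  proof (cases "even (length m)")
    case True
    then have "length m - k = k" by (auto simp: k_def)
    then have m: "m = inv_word (drop k m) @ drop k m" using tk append_take_drop_id by metis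
    then show ?thesis using red not_reduced_inv_word_append by (metis append_Nil inv_word_simps(1))
  next
    case False
    then have k: "k < length m" "length m - Suc k = k" by (auto simp: k_def elim: oddE)
    have "m ! k = inv_word m ! k" using eq by simp
    also have "\<dots> = flip (m ! k)" using k by (simp add: inv_word_def rev_nth)
    finally show ?thesis by (metis flip_neq)
  qed
qed

lemma foldr_push_inv_word: "foldr push s (inv_word s @ q) = q"
  by (induction s arbitrary: q) (simp_all add: inv_word_Cons)

lemma foldr_push_reduced: "reduced (u @ v) \<Longrightarrow> foldr push u v = u @ v"
proof (induction u)
  case (Cons a u)
  then show ?case by (cases "u @ v") (auto simp: reduced_Cons)
qed simp

lemma foldr_push_cancel:
  "reduced (p @ q) \<Longrightarrow> foldr push (p @ s) (inv_word s @ q) = p @ q"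
  by (simp add: foldr_push_inv_word foldr_push_reduced)

text \<open>Here \<open>s\<close> is the part that cancels. In the induction on the left factor, a
  new first letter can cancel only when nothing of the previous left factor survives, that is, when
  \<open>p\<close> is empty.\<close>

lemma foldr_push_decompose:
  assumes "reduced a" "reduced b"
  shows "\<exists>p s q. a = p @ s \<and> b = inv_word s @ q \<and> foldr push a b = p @ q"
  using assms(1)
proof (induction a)
  case Nil
  then show ?case by simp
next
  case (Cons e a)
  then obtain p s q where d: "a = p @ s" "b = inv_word s @ q" "foldr push a b = p @ q"
    by (auto simp: reduced_Cons)
  show ?case
  proof (cases p)
    case Nil
    show ?thesis
    proof (cases "\<exists>q'. q = flip e # q'")
      case True
      then obtain q' where "q = flip e # q'" by blast
      then have "e # a = [] @ (e # s)" "b = inv_word (e # s) @ q'" "foldr push (e # a) b = [] @ q'"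
        using d Nil by (simp_all add: inv_word_Cons)
      then show ?thesis by blast
    next
      case False
      then have "foldr push (e # a) b = [e] @ q" using d Nil by (cases q) auto
      then show ?thesis using d Nil by (metis append_Cons append_Nil)
    qed
  next
    case (Cons f p')
    then have "f \<noteq> flip e" using Cons.prems d by (auto simp: reduced_Cons)
    then have "foldr push (e # a) b = (e # p) @ q" using d Cons by simp
    then show ?thesis using d by (metis append_Cons)
  qed
qed

text \<open>Otherwise the cancelled part \<open>s\<close> is at least as long as \<open>p\<close>,
  so \<open>inv_word s = p @ m\<close>; comparing the two factorizations of \<open>b\<close> makes
  \<open>m\<close> its own inverse, hence empty, and \<open>b = inv_word s @ s\<close> is not
  reduced. This settles Nielsen's conditions for equal neighbours.\<close>

lemma length_foldr_push_self:
  assumes "reduced b" "b \<noteq> []"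
  shows "length b < length (foldr push b b)"
proof (rule ccontr)
  assume neg: "\<not> ?thesis"
  obtain p s q where d: "b = p @ s" "b = inv_word s @ q" "foldr push b b = p @ q"
    using foldr_push_decompose[OF assms(1) assms(1)] by blast
  have len: "length p = length q" using d(1,2) by (metis add.commute add_left_cancel inv_word_simps(4) length_append)
  with neg d have ps: "length p \<le> length s" by (metis add_le_cancel_left leI length_append)
  then obtain m where m: "inv_word s = p @ m"
    using d(1,2) by (metis append_eq_append_conv_if append_take_drop_id inv_word_simps(4))
  then have "s = inv_word m @ inv_word p" by (metis inv_word_simps(2,3))
  then have "p @ inv_word m @ inv_word p = p @ m @ q" using d m by simp
  then have "m = inv_word m" using len by simp
  moreover have "reduced m"
    using assms(1) d(2) m by (simp add: reduced_append)
  ultimately have "m = []" using reduced_eq_inv_word by blast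
  then have "b = inv_word s @ s" using \<open>s = inv_word m @ inv_word p\<close> m d(1) by simp
  moreover have "s \<noteq> []" using calculation assms(2) by auto
  ultimately show False using not_reduced_inv_word_append assms(1) by metis
qed

lemma free_group_simps:
  "monoid.mult (free_group X) = foldr push" "one (free_group X) = []"
  by (simp_all add: free_group_def)

lemma carrier_free_groupD:
  "w \<in> carrier (free_group X) \<Longrightarrow> reduced w"
  "w \<in> carrier (free_group X) \<Longrightarrow> w \<in> lists (X \<times> UNIV)"
  by (auto simp: free_group_def)

lemma inv_word_closed: "w \<in> carrier (free_group X) \<Longrightarrow> inv_word w \<in> carrier (free_group X)"
  by (auto simp: free_group_def reduced_inverse inv_word_def) (metis fst_conv fst_flip mem_Times_iff subsetD)

lemma inv_free_group:
  assumes "w \<in> carrier (free_group X)"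
  shows "m_inv (free_group X) w = inv_word w"
proof -
  interpret group "free_group X" by (rule group_free_group)
  show ?thesis
    using assms inv_word_closed[OF assms] foldr_push_inverse[of w]
    by (intro inv_equality) (simp_all add: inv_word_def free_group_simps)
qed

section \<open>Nielsen reduction in rank two\<close>

text \<open>Nielsen's conditions (N1) and (N2). If \<open>c(a, b)\<close> letters of \<open>a\<close> cancel in the product \<open>a b\<close>, then
  \<open>2 c(a, b) = length a + length b - length (a b)\<close>, so \<open>N2\<close> says \<open>c(a, b) + c(b, c) < length b\<close>.\<close>

lemma nielsen_reduced_length:
  fixes U :: "'a letter list set"
  assumes U: "\<And>a. a \<in> U \<Longrightarrow> reduced a \<and> a \<noteq> []"
    and N1: "\<And>a b. a \<in> U \<Longrightarrow> b \<in> U \<Longrightarrow> foldr push a b \<noteq> [] \<Longrightarrow>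
      length a \<le> length (foldr push a b) \<and> length b \<le> length (foldr push a b)"
    and N2: "\<And>a b c. a \<in> U \<Longrightarrow> b \<in> U \<Longrightarrow> c \<in> U \<Longrightarrow> foldr push a b \<noteq> [] \<Longrightarrow> foldr push b c \<noteq> [] \<Longrightarrow>
      length a + length c < length (foldr push a b) + length (foldr push b c)"
    and as: "set as \<subseteq> U" "successively (\<lambda>a b. foldr push a b \<noteq> []) as" "length as \<ge> 2"
  shows "length (foldr (foldr push) as []) \<ge> 2"
proof -
  \<comment> \<open>Induction invariant: the part \<open>p\<close> of \<open>a\<close> that survives
    the cancellation with its neighbour \<open>b\<close> is a prefix of the whole product. The
    length equation only says that \<open>s\<close> is what \<open>a\<close> and \<open>b\<close>
    cancel.\<close>
  have "\<exists>p s w. a = p @ s \<and> 2 * length s + length (foldr push a b) = length a + length b \<and>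
      foldr (foldr push) (a # b # cs) [] = p @ w \<and> reduced (p @ w) \<and> length (p @ w) \<ge> 2"
    if "set (a # b # cs) \<subseteq> U" "successively (\<lambda>a b. foldr push a b \<noteq> []) (a # b # cs)" for a b cs
    using that
  proof (induction cs arbitrary: a b)
    case Nil
    then have ab: "a \<in> U" "b \<in> U" "foldr push a b \<noteq> []" by simp_all
    obtain p s q where d: "a = p @ s" "b = inv_word s @ q" "foldr push a b = p @ q"
      using foldr_push_decompose U ab(1,2) by metis
    have "length a \<ge> 1" "length b \<ge> 1" using U ab by (simp_all add: Suc_le_eq)
    moreover have len: "2 * length s + length (foldr push a b) = length a + length b" using d by simp
    ultimately have "length (foldr push a b) \<ge> 2" using N1[OF ab] by presburger
    moreover have "reduced (foldr push a b)" using U ab(2) reduced_foldr_push by blast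
    moreover have "foldr (foldr push) [a, b] [] = p @ q"
      using d(3) U[OF ab(2)] by (simp add: foldr_push_Nil)
    ultimately show ?case using d len by metis
  next
    case (Cons c cs)
    let ?w = "foldr (foldr push) (b # c # cs) []"
    have ab: "a \<in> U" "b \<in> U" "foldr push a b \<noteq> []" "c \<in> U" "foldr push b c \<noteq> []"
      using Cons.prems by simp_all
    obtain p s w where w: "b = p @ s" "2 * length s + length (foldr push b c) = length b + length c"
      "?w = p @ w" "reduced (p @ w)" "length (p @ w) \<ge> 2"
      using Cons.IH[of b c] Cons.prems by auto
    obtain p0 s0 q0 where d: "a = p0 @ s0" "b = inv_word s0 @ q0" "foldr push a b = p0 @ q0"
      using foldr_push_decompose U ab(1,2) by metis
    have len: "2 * length s0 + length (foldr push a b) = length a + length b" using d by simp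
    \<comment> \<open>By \<open>N2\<close>, what \<open>a\<close> cancels at the front of
      \<open>b\<close> and what \<open>c\<close> cancels at its end leave a nonempty middle part
      \<open>p'\<close> of \<open>b\<close>, which shields the rest \<open>w\<close> of the product
      from \<open>a\<close>.\<close>
    then have lt: "length s0 < length p"
      using N2[OF ab(1,2,4,3,5)] w(1,2) by simp
    have "take (length s0) p = take (length s0) (p @ s)" using lt by simp
    also have "\<dots> = inv_word s0" using d(2) w(1) by simp
    finally have "take (length s0) p = inv_word s0" .
    then obtain p' where p': "p = inv_word s0 @ p'" "p' \<noteq> []"
      by (metis append_Nil2 append_take_drop_id inv_word_simps(4) less_irrefl lt)
    have "q0 = p' @ s" using d(2) w(1) p' by simp
    moreover have "reduced (p0 @ q0)" using d(3) reduced_foldr_push U ab(2) by metis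
    ultimately have "reduced (p0 @ p' @ w)"
      using w(4) p' by (auto simp: reduced_append)
    moreover from this have "foldr (foldr push) (a # b # c # cs) [] = p0 @ p' @ w"
      using foldr_push_cancel[of p0 "p' @ w" s0] w(3) p' d(1) by simp
    \<comment> \<open>By \<open>N1\<close> at most half of \<open>a\<close> cancels, so the gained
      prefix \<open>p0\<close> makes up for the lost letters of \<open>p\<close>.\<close>
    moreover have "length s0 \<le> length p0" using N1[OF ab(1-3)] d by simp
    then have "length (p0 @ p' @ w) \<ge> 2" using w(5) p' by simp
    ultimately show ?case using d(1) len by metis
  qed
  then show ?thesis using as by (cases as; cases "tl as") fastforce+
qed

text \<open>The moves \<open>rotate\<close> and \<open>shear\<close> are chosen because they are induced by conjugation with braids;
  together with \<open>reflect\<close> and \<open>conjugate\<close> they yield all Nielsen moves.\<close>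

inductive nielsen_pair :: "nat letter list \<Rightarrow> nat letter list \<Rightarrow> bool" where
  basis: "nielsen_pair [(0, True)] [(1, True)]"
| rotate: "nielsen_pair u v \<Longrightarrow> nielsen_pair v (inv_word u)"
| shear: "nielsen_pair u v \<Longrightarrow> nielsen_pair u (foldr push v (inv_word u))"
| reflect: "nielsen_pair u v \<Longrightarrow> nielsen_pair (inv_word u) v"
| conjugate: "nielsen_pair u v \<Longrightarrow> g \<in> carrier F2 \<Longrightarrow>
    nielsen_pair (foldr push (foldr push g u) (inv_word g)) (foldr push (foldr push g v) (inv_word g))"

lemma nielsen_pair_swap: "nielsen_pair u v \<Longrightarrow> nielsen_pair v u"
  by (metis inv_word_simps(3) nielsen_pair.reflect nielsen_pair.rotate)

lemma nielsen_pair_inv2: "nielsen_pair u v \<Longrightarrow> nielsen_pair u (inv_word v)"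
  by (metis nielsen_pair.reflect nielsen_pair_swap)


lemma length_foldr_push_le: "length (foldr push u v) \<le> length u + length v"
proof (induction u)
  case (Cons a u)
  have "length (push a w) \<le> Suc (length w)" for w by (cases w) auto
  then show ?case using Cons by (metis add_Suc foldr.simps(2) le_trans Suc_le_mono length_Cons comp_apply)
qed simp

lemma append_in_carrier_free_group:
  assumes "u @ v \<in> carrier (free_group X)"
  shows "u \<in> carrier (free_group X)" "v \<in> carrier (free_group X)" "u \<otimes>\<^bsub>free_group X\<^esub> v = u @ v"
  using assms by (auto simp: free_group_def reduced_append foldr_push_reduced)

text \<open>The products of this shape are closed under left multiplication by a generator or its
  inverse: if it cancels the first factor, that factor is dropped, otherwise the new factor is
  prepended.\<close>

lemma generate_as_product:
  assumes S: "S \<subseteq> carrier (free_group X)" and h: "h \<in> generate (free_group X) S"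
  shows "\<exists>as. set as \<subseteq> (S \<union> inv_word ` S) - {[]} \<and>
    successively (\<lambda>a b. foldr push a b \<noteq> []) as \<and> foldr (foldr push) as [] = h"
    (is "?P h")
proof -
  have red: "reduced (foldr (foldr push) as [])" for as :: "'a letter list list"
    by (induction as) (simp_all add: reduced_foldr_push)
  have mult1: "?P (foldr push a h)" if a: "a \<in> S \<union> inv_word ` S" and h: "?P h" for a h
  proof (cases "a = []")
    case True
    then show ?thesis using h by simp
  next
    case False
    obtain as where as: "set as \<subseteq> (S \<union> inv_word ` S) - {[]}"
      "successively (\<lambda>a b. foldr push a b \<noteq> []) as" "foldr (foldr push) as [] = h" using h by blast
    show ?thesis
    proof (cases "\<exists>b bs. as = b # bs \<and> foldr push a b = []")
      case True
      then obtain b bs where b: "as = b # bs" "foldr push a b = []" by blast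
      have "foldr push a h = foldr (foldr push) bs []"
        using as(3) b foldr_push_assoc[OF red, of a b bs] by simp
      then show ?thesis using as(1,2) b by (intro exI[of _ bs]) (auto simp: successively_Cons)
    next
      case False
      then have "successively (\<lambda>a b. foldr push a b \<noteq> []) (a # as)"
        using as(2) by (cases as) auto
      then show ?thesis using as a \<open>a \<noteq> []\<close> by (intro exI[of _ "a # as"]) auto
    qed
  qed
  have mult: "?P (foldr push (foldr (foldr push) as []) h)"
    if "set as \<subseteq> S \<union> inv_word ` S" "?P h" for as h
    using that(1)
  proof (induction as)
    case Nil
    then show ?case using that(2) by simp
  next
    case (Cons a as)
    have "reduced h" using that(2) red by blast
    then show ?case
      using Cons mult1[of a "foldr push (foldr (foldr push) as []) h"] by (simp add: foldr_push_assoc)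
  qed
  have one: "?P []" by (rule exI[of _ "[]"]) simp
  show ?thesis using h
  proof (induction rule: generate.induct)
    case one
    then show ?case using \<open>?P []\<close> by (simp add: free_group_simps)
  next
    case (incl h)
    then have "foldr push h [] = h" using S carrier_free_groupD(1) foldr_push_Nil by blast
    then show ?case using mult1[OF _ one, of h] incl by simp
  next
    case (inv h)
    then have "h \<in> carrier (free_group X)" using S by blast
    then have "m_inv (free_group X) h = foldr push (inv_word h) []"
      by (metis inv_free_group carrier_free_groupD(1) foldr_push_Nil reduced_inv_word)
    then show ?case using mult1[OF _ one, of "inv_word h"] inv by simp
  next
    case (eng h1 h2)
    obtain as where "set as \<subseteq> S \<union> inv_word ` S" "foldr (foldr push) as [] = h1"
      using eng.IH(1) by blast
    then show ?case using mult[OF _ eng.IH(2), of as] by (simp add: free_group_simps)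
  qed
qed

lemma (in group) generate_conjugate:
  assumes S: "S \<subseteq> carrier G" and g: "g \<in> carrier G" and h: "h \<in> generate G S"
  shows "g \<otimes> h \<otimes> inv g \<in> generate G ((\<lambda>s. g \<otimes> s \<otimes> inv g) ` S)"
  using h
proof (induction rule: generate.induct)
  case one
  then show ?case using g by (simp add: generate.one)
next
  case (incl h)
  then show ?case by (blast intro: generate.incl)
next
  case (inv h)
  then have "h \<in> carrier G" using S by blast
  then have "g \<otimes> inv h \<otimes> inv g = inv (g \<otimes> h \<otimes> inv g)"
    using g by (simp add: inv_mult_group m_assoc)
  then show ?case using inv by (metis generate.inv imageI)
next
  case (eng h1 h2)
  have cl: "h1 \<in> carrier G" "h2 \<in> carrier G" using eng S generate_in_carrier by blast+
  have "inv g \<otimes> (g \<otimes> (h2 \<otimes> inv g)) = h2 \<otimes> inv g"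
    using cl g by (simp flip: m_assoc)
  then have "g \<otimes> (h1 \<otimes> h2) \<otimes> inv g = (g \<otimes> h1 \<otimes> inv g) \<otimes> (g \<otimes> h2 \<otimes> inv g)"
    using cl g by (simp add: m_assoc)
  then show ?case using eng.IH by (metis generate.eng)
qed

text \<open>Conjugation by the inverse of \<open>u\<close> fixes \<open>u\<close> and turns the
  right multiplication of \<open>shear\<close> into a left one.\<close>

lemma nielsen_pair_left_shear:
  assumes "nielsen_pair u v" "u \<in> carrier F2" "v \<in> carrier F2"
  shows "nielsen_pair u (foldr push (inv_word u) v)"
proof -
  interpret F: group F2 by (rule group_free_group)
  have mult: "foldr push a b = a \<otimes>\<^bsub>F2\<^esub> b" for a b :: "nat letter list"
    by (simp add: free_group_simps)
  have inv: "inv_word u = inv\<^bsub>F2\<^esub> u" using assms(2) by (simp add: inv_free_group)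
  note u = assms(2) and v = assms(3)
  have "nielsen_pair (inv\<^bsub>F2\<^esub> u \<otimes>\<^bsub>F2\<^esub> u \<otimes>\<^bsub>F2\<^esub> u) (inv\<^bsub>F2\<^esub> u \<otimes>\<^bsub>F2\<^esub> v \<otimes>\<^bsub>F2\<^esub> u)"
    using nielsen_pair.conjugate[OF assms(1) inv_word_closed[OF u]] by (simp add: mult inv[symmetric])
  then have "nielsen_pair u (inv\<^bsub>F2\<^esub> u \<otimes>\<^bsub>F2\<^esub> v \<otimes>\<^bsub>F2\<^esub> u)" using u by simp
  from nielsen_pair.shear[OF this] show ?thesis
    unfolding mult inv using u v by (simp add: F.m_assoc)
qed

lemma generate_pair_eqI:
  assumes "generate F2 {u, v} = carrier F2" "a \<in> carrier F2" "b \<in> carrier F2"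
    and "u \<in> generate F2 {a, b}" "v \<in> generate F2 {a, b}"
  shows "generate F2 {a, b} = carrier F2"
proof -
  interpret F: group F2 by (rule group_free_group)
  have "generate F2 {u, v} \<subseteq> generate F2 {a, b}"
    using assms by (intro F.generate_subgroup_incl F.generate_is_subgroup) auto
  moreover have "generate F2 {a, b} \<subseteq> carrier F2"
    using assms F.generate_incl by simp
  ultimately show ?thesis using assms(1) by simp
qed

text \<open>Induction on the total length. In a counterexample no Nielsen move shortens the pair,
  which is \<open>N1\<close>. A failure of \<open>N2\<close> is either contradictory or yields a
  shorter pair after a move and a conjugation. So the pair is Nielsen reduced; then every one-letter
  word occurs among its components and their inverses, and the pair is the basis up to order and
  signs.\<close>

theorem nielsen_pair_if_generates:
  assumes "u \<in> carrier F2" "v \<in> carrier F2" "generate F2 {u, v} = carrier F2"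
  shows "nielsen_pair u v"
  using assms
proof (induction "length u + length v" arbitrary: u v rule: less_induct)
  case less
  interpret F: group F2 by (rule group_free_group)
  note u = less.prems(1) and v = less.prems(2) and gen = less.prems(3)
  have mult: "foldr push a b = a \<otimes>\<^bsub>F2\<^esub> b" for a b :: "nat letter list"
    by (simp add: free_group_simps)
  have inv: "inv_word a = inv\<^bsub>F2\<^esub> a" if "a \<in> carrier F2" for a
    using that by (simp add: inv_free_group)
  have red: "reduced a" if "a \<in> carrier F2" for a
    using that by (rule carrier_free_groupD)
  \<comment> \<open>The versions of the pair up to order and inversion. Each has the same total
    length, generates \<open>F2\<close>, and is a Nielsen pair only if the original is, so any of
    them may be treated in its place.\<close>
  define E where "E a b \<longleftrightarrow> (a \<in> {u, inv_word u} \<and> b \<in> {v, inv_word v}) \<or>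
    (a \<in> {v, inv_word v} \<and> b \<in> {u, inv_word u})" for a b
  have E_carrier: "a \<in> carrier F2" "b \<in> carrier F2" if "E a b" for a b
    using that u v inv_word_closed by (auto simp: E_def)
  have E_length: "length a + length b = length u + length v" if "E a b" for a b
    using that by (auto simp: E_def)
  have E_nielsen: "nielsen_pair u v" if "E a b" "nielsen_pair a b" for a b
    using that nielsen_pair.reflect nielsen_pair_inv2 nielsen_pair_swap
    unfolding E_def by (metis insert_iff inv_word_simps(3) singletonD)
  have E_gen: "generate F2 {a, b} = carrier F2" if "E a b" for a b
  proof (rule generate_pair_eqI[OF gen E_carrier[OF that]])
    have "x \<in> generate F2 {a, b}" if "x \<in> carrier F2" "x \<in> {a, b} \<or> inv_word x \<in> {a, b}" for x
      using that generate.incl generate.inv by (metis F.inv_inv inv)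
    then show "u \<in> generate F2 {a, b}" "v \<in> generate F2 {a, b}"
      using that u v by (auto simp: E_def)
  qed
  have gen_mult: "a \<in> generate F2 {a \<otimes>\<^bsub>F2\<^esub> b, b}" "b \<in> generate F2 {a, a \<otimes>\<^bsub>F2\<^esub> b}"
    if "a \<in> carrier F2" "b \<in> carrier F2" for a b
  proof -
    have "a = a \<otimes>\<^bsub>F2\<^esub> b \<otimes>\<^bsub>F2\<^esub> inv\<^bsub>F2\<^esub> b"
      using that by (simp add: F.m_assoc)
    then show "a \<in> generate F2 {a \<otimes>\<^bsub>F2\<^esub> b, b}"
      by (metis generate.eng generate.incl generate.inv insertCI)
    have "b = inv\<^bsub>F2\<^esub> a \<otimes>\<^bsub>F2\<^esub> (a \<otimes>\<^bsub>F2\<^esub> b)"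
      using that by (simp flip: F.m_assoc)
    then show "b \<in> generate F2 {a, a \<otimes>\<^bsub>F2\<^esub> b}"
      by (metis generate.eng generate.incl generate.inv insertCI)
  qed
  have gen1: "generate F2 {a \<otimes>\<^bsub>F2\<^esub> b, b} = carrier F2" if "E a b" for a b
    by (rule generate_pair_eqI[OF E_gen[OF that]])
      (simp_all add: E_carrier[OF that] gen_mult generate.incl)
  have gen2: "generate F2 {a, a \<otimes>\<^bsub>F2\<^esub> b} = carrier F2" if "E a b" for a b
    by (rule generate_pair_eqI[OF E_gen[OF that]])
      (simp_all add: E_carrier[OF that] gen_mult generate.incl)
  have nielsen1: "nielsen_pair a b" if "nielsen_pair (a \<otimes>\<^bsub>F2\<^esub> b) b" "a \<in> carrier F2" "b \<in> carrier F2" for a b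
  proof -
    have "nielsen_pair b (foldr push (a \<otimes>\<^bsub>F2\<^esub> b) (inv_word b))"
      using nielsen_pair.shear[OF nielsen_pair_swap[OF that(1)]] .
    then have "nielsen_pair b a" using that by (simp only: mult inv) (simp add: F.m_assoc)
    then show ?thesis by (rule nielsen_pair_swap)
  qed
  have nielsen2: "nielsen_pair a b" if "nielsen_pair a (a \<otimes>\<^bsub>F2\<^esub> b)" "a \<in> carrier F2" "b \<in> carrier F2" for a b
  proof -
    have "nielsen_pair a (foldr push (inv_word a) (a \<otimes>\<^bsub>F2\<^esub> b))"
      using nielsen_pair_left_shear[OF that(1,2)] that by simp
    then show ?thesis using that by (simp only: mult inv) (simp flip: F.m_assoc)
  qed
  show ?case
  proof (rule ccontr)
    assume neg: "\<not> nielsen_pair u v"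
    have E_N1: "length a \<le> length (foldr push a b) \<and> length b \<le> length (foldr push a b)" if "E a b" for a b
    proof (rule ccontr)
      assume "\<not> ?thesis"
      then consider "length (a \<otimes>\<^bsub>F2\<^esub> b) < length a" | "length (a \<otimes>\<^bsub>F2\<^esub> b) < length b"
        by (fastforce simp: mult)
      then have "nielsen_pair a b"
      proof cases
        case 1
        then have "nielsen_pair (a \<otimes>\<^bsub>F2\<^esub> b) b"
          using E_carrier[OF that] E_length[OF that] gen1[OF that]
          by (intro less.hyps) auto
        then show ?thesis using nielsen1 E_carrier[OF that] by blast
      next
        case 2
        then have "nielsen_pair a (a \<otimes>\<^bsub>F2\<^esub> b)"
          using E_carrier[OF that] E_length[OF that] gen2[OF that]
          by (intro less.hyps) auto
        then show ?thesis using nielsen2 E_carrier[OF that] by blast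
      qed
      then show False using neg E_nielsen[OF that] by blast
    qed
    define U where "U = ({u, v} \<union> inv_word ` {u, v}) - {[]}"
    have U: "a \<in> carrier F2" "a \<noteq> []" if "a \<in> U" for a
      using that u v inv_word_closed by (auto simp: U_def)
    have U_cases: "E a b \<or> b = a" if "a \<in> U" "b \<in> U" "foldr push a b \<noteq> []" for a b
    proof -
      have "b \<noteq> inv_word a"
        using that(3) foldr_push_inv_word[of a "[]"] by auto
      then show ?thesis using that by (auto simp: U_def E_def)
    qed
    have self: "length b < length (foldr push b b)" if "b \<in> U" for b
      using length_foldr_push_self U[OF that] red by blast
    have N1: "length a \<le> length (foldr push a b) \<and> length b \<le> length (foldr push a b)"
      if "a \<in> U" "b \<in> U" "foldr push a b \<noteq> []" for a b
      using U_cases[OF that] E_N1 self[OF that(2)] by fastforce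
    \<comment> \<open>The tie in which \<open>N1\<close> holds but \<open>N2\<close> fails: the
      first half of \<open>b\<close> is cancelled by \<open>a\<close>, the second half by
      \<open>c\<close>, and \<open>c\<close> is \<open>a\<close> or its inverse. If it is the
      inverse, \<open>b\<close> is not reduced.\<close>
    have E_N2: False
      if ab: "E a b" "E b c" and neg2: "length (foldr push a b) = length a" "length (foldr push b c) = length c"
        "length a = length c" and "b \<noteq> []" for a b c
    proof -
      note cl = E_carrier[OF ab(1)] E_carrier[OF ab(2)]
      obtain p1 s1 q1 where d1: "a = p1 @ s1" "b = inv_word s1 @ q1" "foldr push a b = p1 @ q1"
        using foldr_push_decompose[OF red red] cl by metis
      obtain p2 s2 q2 where d2: "b = p2 @ s2" "c = inv_word s2 @ q2" "foldr push b c = p2 @ q2"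
        using foldr_push_decompose[OF red red] cl by metis
      have len: "length q1 = length s1" "length s2 = length p2" using d1 d2 neg2 by auto
      then have "length p2 = length s1" using d1(2) d2(1)
        by (metis (no_types, lifting) inv_word_simps(4) length_append mult_2 mult_left_cancel zero_neq_numeral)
      then have p2: "p2 = inv_word s1" "s2 = q1" using d1(2) d2(1) by auto
      have "c = a \<or> c = inv_word a"
        using ab unfolding E_def by auto
      then show False
      proof
        assume "c = inv_word a"
        then have "inv_word s2 @ q2 = inv_word s1 @ inv_word p1" using d1 d2 by simp
        then have "s2 = s1" using len p2 by simp
        then have "b = inv_word s1 @ s1" using d1(2) p2 by simp
        moreover have "s1 \<noteq> []" using calculation \<open>b \<noteq> []\<close> by auto
        ultimately show False using not_reduced_inv_word_append red[OF cl(2)] by metis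
      next
        assume c: "c = a"
        have "length b \<le> length a" using E_N1[OF ab(1)] neg2 by simp
        then have "length s1 \<le> length p1" using d1 len by simp
        moreover have "p1 @ s1 = inv_word q1 @ q2" using c d1(1) d2(2) p2 by simp
        ultimately obtain z where z: "p1 = inv_word q1 @ z"
          using len by (metis append_eq_append_conv_if append_take_drop_id inv_word_simps(4))
        \<comment> \<open>Here \<open>b = \<beta> q1\<close> and \<open>a b = q1\<^sup>-\<^sup>1 z q1\<close>, so conjugating the pair \<open>(b, a b)\<close> by \<open>q1\<close> makes it shorter.\<close>
        define \<beta> where "\<beta> = inv_word s1"
        have "\<beta> @ q1 \<in> carrier F2" using cl d1(2) \<beta>_def by simp
        note \<beta> = append_in_carrier_free_group[OF this]
        have "inv_word q1 @ z @ q1 \<in> carrier F2"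
          using F.m_closed[OF cl(1,2)] d1(3) z by (simp add: mult)
        note zq = append_in_carrier_free_group[OF this]
        note z_cl = append_in_carrier_free_group[OF zq(2)]
        let ?b = "q1 \<otimes>\<^bsub>F2\<^esub> \<beta>"
        have b: "b = \<beta> \<otimes>\<^bsub>F2\<^esub> q1" using d1(2) \<beta>(3) \<beta>_def by simp
        have ab_eq: "a \<otimes>\<^bsub>F2\<^esub> b = inv\<^bsub>F2\<^esub> q1 \<otimes>\<^bsub>F2\<^esub> (z \<otimes>\<^bsub>F2\<^esub> q1)"
          using d1(3) z zq(3) z_cl(3) \<beta>(2) by (simp add: mult flip: inv)
        have conj: "q1 \<otimes>\<^bsub>F2\<^esub> b \<otimes>\<^bsub>F2\<^esub> inv\<^bsub>F2\<^esub> q1 = ?b"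
          "q1 \<otimes>\<^bsub>F2\<^esub> (a \<otimes>\<^bsub>F2\<^esub> b) \<otimes>\<^bsub>F2\<^esub> inv\<^bsub>F2\<^esub> q1 = z"
          unfolding ab_eq unfolding b using \<beta>(1,2) z_cl(1) by (simp_all add: F.m_assoc flip: F.m_assoc[of q1 "inv\<^bsub>F2\<^esub> q1"])
        have "length ?b \<le> length b"
          using length_foldr_push_le[of q1 \<beta>] d1(2) by (simp add: mult \<beta>_def)
        moreover have "length z < length a"
          using z d1(1) len \<open>b \<noteq> []\<close> d1(2) by auto
        ultimately have "length ?b + length z < length u + length v"
          using E_length[OF ab(1)] by simp
        moreover have "generate F2 {?b, z} = carrier F2"
        proof (intro equalityI subsetI)
          fix h assume "h \<in> carrier F2"
          moreover have "{a \<otimes>\<^bsub>F2\<^esub> b, b} \<subseteq> carrier F2" using cl by simp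
          ultimately have "q1 \<otimes>\<^bsub>F2\<^esub> (inv\<^bsub>F2\<^esub> q1 \<otimes>\<^bsub>F2\<^esub> h \<otimes>\<^bsub>F2\<^esub> q1) \<otimes>\<^bsub>F2\<^esub> inv\<^bsub>F2\<^esub> q1
              \<in> generate F2 ((\<lambda>s. q1 \<otimes>\<^bsub>F2\<^esub> s \<otimes>\<^bsub>F2\<^esub> inv\<^bsub>F2\<^esub> q1) ` {a \<otimes>\<^bsub>F2\<^esub> b, b})"
            using gen1[OF ab(1)] \<beta>(2) by (intro F.generate_conjugate) auto
          moreover have "q1 \<otimes>\<^bsub>F2\<^esub> (inv\<^bsub>F2\<^esub> q1 \<otimes>\<^bsub>F2\<^esub> h \<otimes>\<^bsub>F2\<^esub> q1) \<otimes>\<^bsub>F2\<^esub> inv\<^bsub>F2\<^esub> q1 = h"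
            using \<open>h \<in> carrier F2\<close> \<beta>(2) by (simp add: F.m_assoc flip: F.m_assoc[of q1 "inv\<^bsub>F2\<^esub> q1"])
          ultimately show "h \<in> generate F2 {?b, z}" by (simp add: conj insert_commute)
        next
          fix h assume "h \<in> generate F2 {?b, z}"
          then show "h \<in> carrier F2" using F.generate_in_carrier[of "{?b, z}"] \<beta> z_cl by simp
        qed
        ultimately have "nielsen_pair ?b z"
          using \<beta> z_cl by (intro less.hyps) auto
        then have "nielsen_pair (inv\<^bsub>F2\<^esub> q1 \<otimes>\<^bsub>F2\<^esub> ?b \<otimes>\<^bsub>F2\<^esub> q1) (inv\<^bsub>F2\<^esub> q1 \<otimes>\<^bsub>F2\<^esub> z \<otimes>\<^bsub>F2\<^esub> q1)"
          using nielsen_pair.conjugate[OF _ inv_word_closed[OF \<beta>(2)], of ?b z]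
          unfolding mult inv_word_simps(3) unfolding inv[OF \<beta>(2)] by blast
        moreover have "inv\<^bsub>F2\<^esub> q1 \<otimes>\<^bsub>F2\<^esub> ?b \<otimes>\<^bsub>F2\<^esub> q1 = b"
          using b \<beta>(1,2) by (simp flip: F.m_assoc)
        moreover have "inv\<^bsub>F2\<^esub> q1 \<otimes>\<^bsub>F2\<^esub> z \<otimes>\<^bsub>F2\<^esub> q1 = a \<otimes>\<^bsub>F2\<^esub> b"
          using ab_eq \<beta>(2) z_cl(1) by (simp add: F.m_assoc)
        ultimately have "nielsen_pair (a \<otimes>\<^bsub>F2\<^esub> b) b" using nielsen_pair_swap by simp
        then show False using nielsen1[OF _ cl(1,2)] E_nielsen[OF ab(1)] neg by blast
      qed
    qed
    have N2: "length a + length c < length (foldr push a b) + length (foldr push b c)"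
      if "a \<in> U" "b \<in> U" "c \<in> U" "foldr push a b \<noteq> []" "foldr push b c \<noteq> []" for a b c
    proof (cases "a = b \<or> b = c")
      case True
      then show ?thesis using N1[OF that(1,2,4)] N1[OF that(2,3,5)] self[OF that(2)] by auto
    next
      case False
      then have E: "E a b" "E b c" using U_cases that by blast+
      then have "length a = length c" using E_length[OF E(1)] E_length[OF E(2)] by simp
      then show ?thesis
        using E_N2[OF E] N1[OF that(1,2,4)] N1[OF that(2,3,5)] U(2)[OF that(2)] by fastforce
    qed
    \<comment> \<open>A product of two or more factors from the reduced set has length at least 2,
      so a one-letter word is a single factor.\<close>
    have letter_in_U: "w \<in> U" if w: "w \<in> carrier F2" "length w = 1" for w
    proof -
      have "w \<in> generate F2 {u, v}" using w gen by simp
      then obtain as where as: "set as \<subseteq> U" "successively (\<lambda>a b. foldr push a b \<noteq> []) as"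
        "foldr (foldr push) as [] = w"
        using generate_as_product[of "{u, v}" "{..<2}" w] u v unfolding U_def by auto
      have "\<not> length as \<ge> 2"
        using nielsen_reduced_length[of U as] as N1 N2 U red w(2) by fastforce
      moreover have "as \<noteq> []" using as(3) w(2) by auto
      ultimately obtain a where "as = [a]"
        by (cases as; cases "tl as") (auto simp: not_le)
      then have "w = a" "a \<in> U" using as U(1)[of a] red foldr_push_Nil by auto
      then show ?thesis by simp
    qed
    have "[(0, True)] \<in> U" "[(1, True)] \<in> U"
      by (rule letter_in_U; simp add: free_group_def reduced_Cons)+
    then have "E [(0, True)] [(1, True)]"
      using U_cases[of "[(0, True)]" "[(1, True)]"] by (simp add: flip_def)
    then show False using E_nielsen nielsen_pair.basis neg by blast
  qed
qed

section \<open>Linear representations from group actions\<close>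

definition complex_ring :: "complex ring" where
  "complex_ring = \<lparr>carrier = UNIV, monoid.mult = (*), one = 1, zero = 0, add = (+)\<rparr>"

lemma complex_ring_simps [simp]:
  "carrier complex_ring = UNIV" "x \<otimes>\<^bsub>complex_ring\<^esub> y = x * y" "\<one>\<^bsub>complex_ring\<^esub> = 1"
  "\<zero>\<^bsub>complex_ring\<^esub> = 0" "x \<oplus>\<^bsub>complex_ring\<^esub> y = x + y"
  by (simp_all add: complex_ring_def)

lemma field_complex_ring: "field complex_ring"
proof -
  have "cring complex_ring"
  proof (rule cringI)
    show "abelian_group complex_ring"
    proof (rule abelian_groupI)
      fix x assume "x \<in> carrier complex_ring"
      show "\<exists>y \<in> carrier complex_ring. y \<oplus>\<^bsub>complex_ring\<^esub> x = \<zero>\<^bsub>complex_ring\<^esub>"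
        by (rule bexI[of _ "- x"]) simp_all
    qed (simp_all add: algebra_simps)
    show "comm_monoid complex_ring" by (rule comm_monoidI) (simp_all add: algebra_simps)
  qed (simp add: algebra_simps)
  then show ?thesis
  proof (rule cring.cring_fieldI2)
    fix a assume "a \<noteq> \<zero>\<^bsub>complex_ring\<^esub>"
    then show "\<exists>b \<in> carrier complex_ring. a \<otimes>\<^bsub>complex_ring\<^esub> b = \<one>\<^bsub>complex_ring\<^esub>"
      by (intro bexI[of _ "inverse a"]) simp_all
  qed simp
qed

lemma char_zero_complex_ring: "char_zero complex_ring"
proof -
  interpret field complex_ring by (rule field_complex_ring)
  have "[n] \<cdot>\<^bsub>complex_ring\<^esub> \<one>\<^bsub>complex_ring\<^esub> = of_nat n" for n :: nat
  proof (induction n)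
    case (Suc n)
    then show ?case by (simp add: add.nat_pow_Suc)
  qed (simp add: add.nat_pow_0)
  then show ?thesis by (simp add: char_zero_def)
qed

lemma finsum_complex_ring: "finite A \<Longrightarrow> finsum complex_ring f A = sum f A"
proof (induction A rule: finite_induct)
  case empty
  interpret field complex_ring by (rule field_complex_ring)
  show ?case by simp
next
  case (insert x A)
  interpret field complex_ring by (rule field_complex_ring)
  show ?case using insert by (subst finsum_insert) auto
qed

text \<open>The representation space is the span of \<open>f ` X\<close>; the maps \<open>L\<close> need not depend
  multiplicatively on the group element, but their restrictions to that span do.\<close>

lemma faithful_representation_of_action:
  fixes \<Gamma> :: "('g, 'b) monoid_scheme" and f :: "'x \<Rightarrow> 'v::euclidean_space"
  assumes "group \<Gamma>"
    and act_closed: "\<And>g x. g \<in> carrier \<Gamma> \<Longrightarrow> x \<in> X \<Longrightarrow> act g x \<in> X"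
    and act_mult: "\<And>g h x. g \<in> carrier \<Gamma> \<Longrightarrow> h \<in> carrier \<Gamma> \<Longrightarrow> x \<in> X \<Longrightarrow>
      act (g \<otimes>\<^bsub>\<Gamma>\<^esub> h) x = act g (act h x)"
    and act_one: "\<And>x. x \<in> X \<Longrightarrow> act \<one>\<^bsub>\<Gamma>\<^esub> x = x"
    and act_faithful: "\<And>g h. g \<in> carrier \<Gamma> \<Longrightarrow> h \<in> carrier \<Gamma> \<Longrightarrow>
      (\<And>x. x \<in> X \<Longrightarrow> act g x = act h x) \<Longrightarrow> g = h"
    and f: "inj_on f X" "\<exists>x \<in> X. f x \<noteq> 0"
    and lin: "\<And>g. g \<in> carrier \<Gamma> \<Longrightarrow> \<exists>L. linear L \<and> (\<forall>x \<in> X. f (act g x) = L (f x))"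
  shows "\<exists>d > 0. \<exists>\<rho>. \<rho> \<in> mon \<Gamma> (GL d complex_ring)"
proof -
  interpret group \<Gamma> by fact
  interpret K: field complex_ring by (rule field_complex_ring)
  \<comment> \<open>The basis is taken inside \<open>f\<close> X\<open>, which the maps\<close>L
    g\<open>permute; so the span is invariant, and the multiplicativity
    of\<close>L\<open>on\<close>f \<open>X\<close> suffices.\<close>
  obtain B where B: "B \<subseteq> f ` X" "independent B" "f ` X \<subseteq> span B"
    using real_vector.maximal_independent_subset by blast
  then have fin: "finite B" using independent_imp_finite by blast
  define d where "d = card B"
  obtain b where b: "bij_betw b {..<d} B"
    using ex_bij_betw_nat_finite[OF fin] unfolding d_def lessThan_atLeast0 by blast
  have bB: "b i \<in> B" if "i < d" for i using b that by (auto simp: bij_betw_def)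
  have "B \<noteq> {}" using B(3) f(2) by auto
  then have "d > 0" using fin by (simp add: d_def card_gt_0_iff)
  obtain L where L: "\<And>g. g \<in> carrier \<Gamma> \<Longrightarrow> linear (L g)"
    "\<And>g x. g \<in> carrier \<Gamma> \<Longrightarrow> x \<in> X \<Longrightarrow> f (act g x) = L g (f x)"
    using lin by metis
  define rep where "rep v i = representation B v (b i)" for v i
  have expand: "v = (\<Sum>i<d. rep v i *\<^sub>R b i)" if "v \<in> span B" for v
  proof -
    have "v = (\<Sum>c\<in>B. representation B v c *\<^sub>R c)"
      using real_vector.sum_representation_eq[OF B(2) that fin] by simp
    also have "\<dots> = (\<Sum>i<d. representation B v (b i) *\<^sub>R b i)"
      by (rule sum.reindex_bij_betw[OF b, symmetric])
    finally show ?thesis by (simp add: rep_def)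
  qed
  have L_image: "L g w \<in> f ` X" if "g \<in> carrier \<Gamma>" "w \<in> f ` X" for g w
    using that(2) L(2)[OF that(1), symmetric] act_closed[OF that(1)] by auto
  have L_span: "L g (b i) \<in> span B" if "g \<in> carrier \<Gamma>" "i < d" for g i
    using L_image[OF that(1)] bB[OF that(2)] B by blast
  have L_mult: "L (g \<otimes>\<^bsub>\<Gamma>\<^esub> h) w = L g (L h w)" if "g \<in> carrier \<Gamma>" "h \<in> carrier \<Gamma>" "w \<in> f ` X" for g h w
    using that(3) L(2)[OF m_closed[OF that(1,2)], symmetric] L(2)[OF that(1), symmetric]
      L(2)[OF that(2), symmetric] act_closed[OF that(2)] act_mult[OF that(1,2)] by auto
  have L_one: "L \<one>\<^bsub>\<Gamma>\<^esub> w = w" if "w \<in> f ` X" for w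
    using that L(2)[OF one_closed, symmetric] act_one by auto
  have rep_L: "rep (L g v) i = (\<Sum>k<d. rep (L g (b k)) i * rep v k)"
    if g: "g \<in> carrier \<Gamma>" and v: "v \<in> span B" for g v i
  proof -
    have "L g v = (\<Sum>k<d. rep v k *\<^sub>R L g (b k))"
      using arg_cong[OF expand[OF v], of "L g"] L(1)[OF g] by (simp add: linear_sum linear_scale)
    then have "rep (L g v) i = (\<Sum>k<d. representation B (rep v k *\<^sub>R L g (b k)) (b i))"
      unfolding rep_def using L_span[OF g]
      by (simp, subst real_vector.representation_sum[OF B(2)]) (simp_all add: span_scale)
    also have "\<dots> = (\<Sum>k<d. rep v k * representation B (L g (b k)) (b i))"
      using L_span[OF g] by (intro sum.cong) (simp_all add: real_vector.representation_scale[OF B(2)])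
    finally show ?thesis by (simp add: rep_def mult.commute)
  qed
  have rep_b: "rep (b j) i = (if i = j then 1 else 0)" if "i < d" "j < d" for i j
    using that b bB[OF that(2)] real_vector.representation_basis[OF B(2)]
    by (auto simp: rep_def bij_betw_def inj_on_def)
  \<comment> \<open>The entries are real; they are only viewed as complex numbers.\<close>
  define \<rho> where "\<rho> g = Matrix.mat d d (\<lambda>(i, j). complex_of_real (rep (L g (b j)) i))" for g
  let ?M = "matrix_monoid complex_ring d"
  have \<rho>_M: "\<rho> g \<in> carrier ?M" for g
    unfolding \<rho>_def by (rule mat_in_matrix_monoid) simp
  have \<rho>_mult: "\<rho> (g \<otimes>\<^bsub>\<Gamma>\<^esub> h) = \<rho> g \<otimes>\<^bsub>?M\<^esub> \<rho> h" if g: "g \<in> carrier \<Gamma>" and h: "h \<in> carrier \<Gamma>" for g h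
  proof (rule eq_matI)
    fix i j assume "i < dim_row (\<rho> g \<otimes>\<^bsub>?M\<^esub> \<rho> h)" "j < dim_col (\<rho> g \<otimes>\<^bsub>?M\<^esub> \<rho> h)"
    then have ij: "i < d" "j < d" by (simp_all add: matrix_monoid_def)
    have "rep (L (g \<otimes>\<^bsub>\<Gamma>\<^esub> h) (b j)) i = (\<Sum>k<d. rep (L g (b k)) i * rep (L h (b j)) k)"
      using L_mult[OF g h] bB[OF ij(2)] B(1) rep_L[OF g L_span[OF h ij(2)]] by auto
    then show "\<rho> (g \<otimes>\<^bsub>\<Gamma>\<^esub> h) $$ (i, j) = (\<rho> g \<otimes>\<^bsub>?M\<^esub> \<rho> h) $$ (i, j)"
      using ij by (simp add: \<rho>_def matrix_monoid_def finsum_complex_ring)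
  qed (simp_all add: \<rho>_def matrix_monoid_def)
  have \<rho>_one: "\<rho> \<one>\<^bsub>\<Gamma>\<^esub> = \<one>\<^bsub>?M\<^esub>"
    using bB B(1) by (intro eq_matI) (auto simp: \<rho>_def matrix_monoid_def L_one rep_b subset_iff)
  have "\<rho> g \<in> Units ?M" if "g \<in> carrier \<Gamma>" for g
    unfolding Units_def using \<rho>_M \<rho>_mult[of g "inv\<^bsub>\<Gamma>\<^esub> g"] \<rho>_mult[of "inv\<^bsub>\<Gamma>\<^esub> g" g] \<rho>_one that
    by auto
  then have "\<rho> \<in> hom \<Gamma> (GL d complex_ring)"
    by (auto simp: hom_def GL_def units_of_def \<rho>_mult)
  moreover have "inj_on \<rho> (carrier \<Gamma>)"
  proof (rule inj_onI)
    fix g h assume g: "g \<in> carrier \<Gamma>" and h: "h \<in> carrier \<Gamma>" and eq: "\<rho> g = \<rho> h"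
    have rep_eq: "rep (L g (b j)) i = rep (L h (b j)) i" if "i < d" "j < d" for i j
      using arg_cong[OF eq, of "\<lambda>A. A $$ (i, j)"] that by (simp add: \<rho>_def)
    have "L g (b j) = L h (b j)" if "j < d" for j
      using expand[OF L_span[OF g that]] expand[OF L_span[OF h that]] rep_eq[OF _ that] by simp
    then have eq_B: "L g c = L h c" if "c \<in> B" for c
      using that b by (auto simp: bij_betw_def)
    have "act g x = act h x" if x: "x \<in> X" for x
    proof -
      have "L g (f x) = L h (f x)"
        using linear_eq_on[OF L(1)[OF g] L(1)[OF h]] eq_B B(3) x by blast
      then show ?thesis
        using L(2)[OF g x] L(2)[OF h x] inj_onD[OF f(1) _ act_closed[OF g x] act_closed[OF h x]]
        by simp
    qed
    then show "g = h" using act_faithful g h by blast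
  qed
  ultimately show ?thesis using \<open>d > 0\<close> by (auto simp: mon_def)
qed

section \<open>The Lawrence--Krammer representation of the braid group on four strands\<close>

datatype braid_gen = Sig1 | Sig2 | Sig3

text \<open>On the path with three nodes, neighbours are pairs of which exactly one is the middle
  node. The negation includes \<open>i = j\<close>, where commutation is trivial.\<close>

definition adj :: "braid_gen \<Rightarrow> braid_gen \<Rightarrow> bool" where
  "adj i j \<longleftrightarrow> (i = Sig2) \<noteq> (j = Sig2)"

text \<open>Equality in the positive braid monoid, without inverses. The relations carry an
  arbitrary tail \<open>w\<close>, so closure under \<open>braid_Cons\<close> already makes this a
  two-sided congruence.\<close>

inductive braid_eq :: "braid_gen list \<Rightarrow> braid_gen list \<Rightarrow> bool" (infix "\<sim>" 50) where
  braid_refl [simp]: "u \<sim> u"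
| braid_sym: "u \<sim> v \<Longrightarrow> v \<sim> u"
| braid_trans [trans]: "u \<sim> v \<Longrightarrow> v \<sim> w \<Longrightarrow> u \<sim> w"
| braid_Cons: "u \<sim> v \<Longrightarrow> i # u \<sim> i # v"
| braid_adj: "adj i j \<Longrightarrow> i # j # i # w \<sim> j # i # j # w"
| braid_far: "\<not> adj i j \<Longrightarrow> i # j # w \<sim> j # i # w"

lemma braid_eq_length: "u \<sim> v \<Longrightarrow> length u = length v"
  by (induction rule: braid_eq.induct) auto

datatype root = R12 | R13 | R14 | R23 | R24 | R34

instance root :: finite
proof
  have "UNIV = {R12, R13, R14, R23, R24, R34}" using root.exhaust by blast
  then show "finite (UNIV :: root set)" by (metis finite.emptyI finite_insert)
qed

text \<open>The coordinates of \<open>\<sigma>\<^sub>i v\<close> in the basis \<open>x\<^sub>i\<^sub>j\<close> of Krammer's paper, at \<open>q = 1/2\<close> and \<open>t = 8 s\<close>; the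
  generators are scaled by \<open>2\<close> so that all coefficients are integral.\<close>

fun lk :: "'a::comm_ring_1 \<Rightarrow> braid_gen \<Rightarrow> 'a ^ root \<Rightarrow> 'a ^ root" where
  "lk s Sig1 v = (\<chi> r. case r of
     R12 \<Rightarrow> 4 * s * (vec_nth v R12 - vec_nth v R13 - vec_nth v R14)
   | R13 \<Rightarrow> 2 * vec_nth v R23
   | R14 \<Rightarrow> 2 * vec_nth v R24
   | R23 \<Rightarrow> vec_nth v R13 + vec_nth v R23
   | R24 \<Rightarrow> vec_nth v R14 + vec_nth v R24
   | R34 \<Rightarrow> 2 * vec_nth v R34)"
| "lk s Sig2 v = (\<chi> r. case r of
     R12 \<Rightarrow> vec_nth v R12 + 2 * vec_nth v R13
   | R13 \<Rightarrow> vec_nth v R12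
   | R14 \<Rightarrow> 2 * vec_nth v R14
   | R23 \<Rightarrow> 2 * s * (vec_nth v R14 - vec_nth v R13 + 2 * vec_nth v R23 - 2 * vec_nth v R24)
   | R24 \<Rightarrow> 2 * vec_nth v R34
   | R34 \<Rightarrow> vec_nth v R24 + vec_nth v R34)"
| "lk s Sig3 v = (\<chi> r. case r of
     R12 \<Rightarrow> 2 * vec_nth v R12
   | R13 \<Rightarrow> vec_nth v R13 + 2 * vec_nth v R14
   | R14 \<Rightarrow> vec_nth v R13
   | R23 \<Rightarrow> vec_nth v R23 + 2 * vec_nth v R24
   | R24 \<Rightarrow> vec_nth v R23
   | R34 \<Rightarrow> s * (4 * vec_nth v R34 - vec_nth v R14 - 2 * vec_nth v R24))"

lemma all_root: "(\<forall>r. P r) \<longleftrightarrow> P R12 \<and> P R13 \<and> P R14 \<and> P R23 \<and> P R24 \<and> P R34"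
  by (metis root.exhaust)

lemma lk_adj: "adj i j \<Longrightarrow> lk s i (lk s j (lk s i v)) = lk s j (lk s i (lk s j v))"
  by (cases i; cases j) (simp_all add: adj_def Finite_Cartesian_Product.vec_eq_iff all_root algebra_simps)

lemma lk_far: "\<not> adj i j \<Longrightarrow> lk s i (lk s j v) = lk s j (lk s i v)"
  by (cases i; cases j) (simp_all add: adj_def Finite_Cartesian_Product.vec_eq_iff all_root algebra_simps)

lemma lk_braid_eq: "u \<sim> v \<Longrightarrow> foldr (lk s) u x = foldr (lk s) v x"
  by (induction rule: braid_eq.induct) (auto intro: lk_adj lk_far)

lemma linear_lk: "linear (lk (s::real) i)"
  by (cases i) (auto intro!: linearI simp: Finite_Cartesian_Product.vec_eq_iff all_root algebra_simps)

lemma lk_eq_0: "(s::real) \<noteq> 0 \<Longrightarrow> lk s i v = 0 \<Longrightarrow> v = 0"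
  by (cases i) (auto simp: Finite_Cartesian_Product.vec_eq_iff all_root)

section \<open>Divisibility of positive braids and faithfulness on positive words\<close>

fun simple_root :: "braid_gen \<Rightarrow> root" where
  "simple_root Sig1 = R12" | "simple_root Sig2 = R23" | "simple_root Sig3 = R34"

abbreviation lk_pos :: "braid_gen list \<Rightarrow> int ^ root" where
  "lk_pos u \<equiv> foldr (lk 0) u 1"

lemma lk_pos_nonneg: "vec_nth (lk_pos u) r \<ge> 0"
proof (induction u arbitrary: r)
  case (Cons i u)
  then show ?case by (cases i; cases r) simp_all
qed simp

text \<open>At \<open>s = 0\<close> the matrices are nonnegative, and the \<open>i\<close>-th generator annihilates the coordinate of
  its simple root. Hence a word is divisible by the \<open>i\<close>-th generator as soon as this coordinate vanishes
  in the image of the all-ones vector.\<close>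

lemma lk_pos_starts_with:
  "vec_nth (lk_pos u) (simple_root i) = 0 \<Longrightarrow> \<exists>u'. u \<sim> i # u'"
proof (induction "length u" arbitrary: u i rule: less_induct)
  case less
  show ?case
  proof (cases u)
    case Nil
    then show ?thesis using less.prems by simp
  next
    case u: (Cons k w)
    note nonneg = lk_pos_nonneg[of w R12] lk_pos_nonneg[of w R13] lk_pos_nonneg[of w R14]
      lk_pos_nonneg[of w R23] lk_pos_nonneg[of w R24] lk_pos_nonneg[of w R34]
    have step: "\<exists>w'. w \<sim> j # w'" if "vec_nth (lk_pos w) (simple_root j) = 0" for j
      using less.hyps[of w j] that u by simp
    consider "i = k" | "i \<noteq> k" "\<not> adj i k" | "adj i k" by blast
    then show ?thesis
    proof cases
      case 1
      then show ?thesis using u by (metis braid_refl)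
    next
      case 2
      then have "vec_nth (lk_pos w) (simple_root i) = 0"
        using less.prems u by (cases i; cases k) (auto simp: adj_def)
      then obtain w' where "w \<sim> i # w'" using step by blast
      then have "u \<sim> k # i # w'" using u by (simp add: braid_Cons)
      also have "\<dots> \<sim> i # k # w'" using 2 by (intro braid_far) (auto simp: adj_def)
      finally show ?thesis by blast
    next
      case 3
      \<comment> \<open>Under the \<open>k\<close>-th generator at 0, the coordinate at the simple
        root of \<open>i\<close> becomes a positive combination of the old coordinates at that root
        and at the sum of the two simple roots; by nonnegativity both vanish for
        \<open>w\<close>.\<close>
      have "vec_nth (lk_pos w) (simple_root i) = 0"
        using less.prems u 3 nonneg by (cases i; cases k) (auto simp: adj_def)
      then obtain w1 where w1: "w \<sim> i # w1" using step by blast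
      note nonneg = lk_pos_nonneg[of w1 R12] lk_pos_nonneg[of w1 R13] lk_pos_nonneg[of w1 R14]
        lk_pos_nonneg[of w1 R23] lk_pos_nonneg[of w1 R24] lk_pos_nonneg[of w1 R34]
      \<comment> \<open>The \<open>i\<close>-th generator moves the coordinate at the simple root of
        \<open>k\<close>, up to a positive factor, to the sum of the two simple roots, where
        \<open>w\<close> has coordinate 0.\<close>
      have "vec_nth (lk_pos w1) (simple_root k) = 0"
        using less.prems u 3 nonneg lk_braid_eq[OF w1, of "0::int" 1]
        by (cases i; cases k) (auto simp: adj_def)
      moreover have "length w1 < length u" using braid_eq_length[OF w1] u by simp
      ultimately obtain w2 where w2: "w1 \<sim> k # w2" using less.hyps by blast
      have "u \<sim> k # i # w1" using u w1 by (simp add: braid_Cons)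
      also have "\<dots> \<sim> k # i # k # w2" using w2 by (simp add: braid_Cons)
      also have "\<dots> \<sim> i # k # i # w2" using 3 by (intro braid_adj) (auto simp: adj_def)
      finally show ?thesis by blast
    qed
  qed
qed

lemma lk_pos_simple_root: "vec_nth (lk_pos (i # u)) (simple_root i) = 0"
  by (cases i) simp_all

lemma ex_transcendental: "\<exists>s::real. \<forall>p::int poly. poly (map_poly of_int p) s = 0 \<longrightarrow> p = 0"
proof -
  have c: "countable (UNIV :: int poly set)"
    by (rule countableI'[of "to_nat \<circ> coeffs"]) (auto intro!: inj_onI simp: coeffs_eq_iff)
  have "finite {s::real. poly (map_poly of_int p) s = 0}" if "p \<noteq> 0" for p :: "int poly"
    using that by (intro poly_roots_finite) (auto simp: map_poly_eq_0_iff)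
  then have "countable (\<Union>p \<in> UNIV - {0 :: int poly}. {s::real. poly (map_poly of_int p) s = 0})"
    using c by (intro countable_UN) (auto intro: countable_finite countable_subset)
  then have "(\<Union>p \<in> UNIV - {0 :: int poly}. {s::real. poly (map_poly of_int p) s = 0}) \<noteq> UNIV"
    using uncountable_UNIV_real by metis
  then show ?thesis by blast
qed

definition map_coords :: "('a \<Rightarrow> 'b) \<Rightarrow> 'a ^ 'n \<Rightarrow> 'b ^ 'n" where
  "map_coords h v = (\<chi> r. h (vec_nth v r))"

lemma lk_map_coords:
  fixes h :: "'a::comm_ring_1 \<Rightarrow> 'b::comm_ring_1"
  assumes add: "\<And>x y. h (x + y) = h x + h y" and mult: "\<And>x y. h (x * y) = h x * h y"
    and one: "h 1 = 1"
  shows "lk (h s) i (map_coords h v) = map_coords h (lk s i v)"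
proof -
  have diff: "h (x - y) = h x - h y" for x y
    using add[of "x - y" y] by (simp add: algebra_simps)
  have "h 2 = 2" using add[of 1 1] one by simp
  moreover from this have "h 4 = 4" using add[of 2 2] by simp
  ultimately show ?thesis
    by (cases i) (simp_all add: map_coords_def Finite_Cartesian_Product.vec_eq_iff all_root add mult diff)
qed

lemma foldr_lk_map_coords:
  fixes h :: "'a::comm_ring_1 \<Rightarrow> 'b::comm_ring_1"
  assumes "\<And>x y. h (x + y) = h x + h y" and "\<And>x y. h (x * y) = h x * h y"
    and one: "h 1 = 1"
  shows "foldr (lk (h s)) u 1 = map_coords h (foldr (lk s) u 1)"
proof (induction u)
  case Nil
  then show ?case by (simp add: map_coords_def Finite_Cartesian_Product.vec_eq_iff one)
next
  case (Cons i u)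
  then show ?case using lk_map_coords[of h, OF assms] by simp
qed

text \<open>Evaluation at \<open>s\<close> is injective on integral polynomials, so equal images of
  the all-ones vector stay equal after replacing \<open>s\<close> by 0. There the first generator of
  \<open>u\<close> is seen to divide \<open>v\<close>; it is cancelled at \<open>s\<close>, where
  the generators are injective.\<close>

lemma lk_faithful_on_words:
  fixes s :: real
  assumes s: "\<forall>p::int poly. poly (map_poly of_int p) s = 0 \<longrightarrow> p = 0"
    and "\<And>x. foldr (lk s) u x = foldr (lk s) v x"
  shows "u \<sim> v"
  using assms(2)
proof (induction u arbitrary: v)
  define ev where "ev p = poly (map_poly of_int p) s" for p :: "int poly"
  have add: "ev (p + q) = ev p + ev q" for p q
  proof -
    have "map_poly real_of_int (p + q) = map_poly of_int p + map_poly of_int q"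
      by (rule poly_eqI) (simp add: coeff_map_poly)
    then show ?thesis by (simp add: ev_def)
  qed
  have mult: "ev (p * q) = ev p * ev q" for p q
  proof -
    have "map_poly real_of_int (p * q) = map_poly of_int p * map_poly of_int q"
      by (rule poly_eqI) (simp add: coeff_map_poly coeff_mult)
    then show ?thesis by (simp add: ev_def)
  qed
  have ev1: "ev 1 = 1" and evX: "ev [:0, 1:] = s" by (simp_all add: ev_def map_poly_pCons)
  have diff: "ev (p - q) = ev p - ev q" for p q
    using add[of "p - q" q] by simp
  have inj: "ev p = ev q \<Longrightarrow> p = q" for p q
    using s diff[of p q] by (auto simp: ev_def)
  have lk_pos_eq: "lk_pos u = lk_pos v" if eq: "foldr (lk s) u 1 = foldr (lk s) v 1" for u v
  proof -
    have "foldr (lk s) w 1 = map_coords ev (foldr (lk [:0, 1:]) w 1)" for w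
      using foldr_lk_map_coords[of ev "[:0, 1:]", OF add mult ev1] evX by simp
    then have "foldr (lk [:0, 1 :: int:]) u 1 = foldr (lk [:0, 1:]) v 1"
      using eq inj by (simp add: map_coords_def Finite_Cartesian_Product.vec_eq_iff)
    moreover have "lk_pos w = map_coords (\<lambda>p. poly p 0) (foldr (lk [:0, 1:]) w 1)" for w
      using foldr_lk_map_coords[of "\<lambda>p::int poly. poly p 0" "[:0, 1:]"] by simp
    ultimately show ?thesis by simp
  qed
  have "s \<noteq> 0"
    using inj[of "[:0, 1:]" 0] evX by (auto simp: ev_def)
  {
    case Nil
    then have "lk_pos v = 1" using lk_pos_eq[of "[]" v] by simp
    \<comment> \<open>A nonempty word produces a zero coordinate, which the all-ones vector does not
      have.\<close>
    then have "v = []"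
      using lk_pos_simple_root by (cases v) (metis one_index zero_neq_one)+
    then show ?case by simp
  next
    case (Cons i u)
    have "vec_nth (lk_pos v) (simple_root i) = 0"
      using lk_pos_simple_root[of i u] lk_pos_eq[of "i # u" v] Cons.prems by simp
    then obtain v' where v': "v \<sim> i # v'" using lk_pos_starts_with by blast
    have "lk s i (foldr (lk s) u x - foldr (lk s) v' x) = 0" for x
      using Cons.prems[of x] lk_braid_eq[OF v', of s x] linear_lk[of s i]
      by (simp add: linear_diff)
    then have "foldr (lk s) u x = foldr (lk s) v' x" for x
      using lk_eq_0[OF \<open>s \<noteq> 0\<close>] by (metis eq_iff_diff_eq_0)
    then have "u \<sim> v'" by (rule Cons.IH)
    then show ?case using v' by (metis braid_Cons braid_sym braid_trans)
  }
qed

section \<open>From positive words to groups with elements satisfying the braid relations\<close>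

definition matrix_group :: "(real ^ 'n ^ 'n) monoid" where
  "matrix_group = \<lparr>carrier = {A. invertible A}, monoid.mult = (**),
     one = Finite_Cartesian_Product.mat 1\<rparr>"

lemma matrix_group_simps [simp]:
  "A \<in> carrier matrix_group \<longleftrightarrow> invertible A" "A \<otimes>\<^bsub>matrix_group\<^esub> B = A ** B"
  "\<one>\<^bsub>matrix_group\<^esub> = Finite_Cartesian_Product.mat 1"
  by (simp_all add: matrix_group_def)

lemma group_matrix_group: "group (matrix_group :: (real ^ 'n ^ 'n) monoid)"
proof (rule groupI)
  fix A :: "real ^ 'n ^ 'n" assume "A \<in> carrier matrix_group"
  then obtain B where "A ** B = Finite_Cartesian_Product.mat 1" "B ** A = Finite_Cartesian_Product.mat 1"
    by (auto simp: invertible_def)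
  then show "\<exists>B \<in> carrier matrix_group. B \<otimes>\<^bsub>matrix_group\<^esub> A = \<one>\<^bsub>matrix_group\<^esub>"
    by (intro bexI[of _ B]) (auto simp: invertible_def)
qed (auto simp: invertible_mult matrix_mul_assoc simp: invertible_def[of "Finite_Cartesian_Product.mat 1"])

text \<open>An image of the braid group inside an arbitrary group that it need not generate. The
  instances are the matrix group, the automorphism group of \<open>F2\<close> and their direct
  product.\<close>

locale braid4 = group G for G (structure) +
  fixes \<sigma> :: "braid_gen \<Rightarrow> 'a"
  assumes gen_closed [simp]: "\<sigma> i \<in> carrier G"
    and gen_adj: "adj i j \<Longrightarrow> \<sigma> i \<otimes> \<sigma> j \<otimes> \<sigma> i = \<sigma> j \<otimes> \<sigma> i \<otimes> \<sigma> j"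
    and gen_far: "\<not> adj i j \<Longrightarrow> \<sigma> i \<otimes> \<sigma> j = \<sigma> j \<otimes> \<sigma> i"
begin

definition eval_word :: "braid_gen list \<Rightarrow> 'a" where
  "eval_word w = foldr (\<lambda>i g. \<sigma> i \<otimes> g) w \<one>"

lemma eval_word_simps [simp]:
  "eval_word [] = \<one>" "eval_word (i # w) = \<sigma> i \<otimes> eval_word w"
  by (simp_all add: eval_word_def)

lemma eval_word_closed [simp]: "eval_word w \<in> carrier G"
  by (induction w) simp_all

lemma eval_word_append: "eval_word (u @ v) = eval_word u \<otimes> eval_word v"
  by (induction u) (simp_all add: m_assoc)

lemma eval_word_braid_eq: "u \<sim> v \<Longrightarrow> eval_word u = eval_word v"
proof (induction rule: braid_eq.induct)
  case (braid_adj i j w)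
  then show ?case using gen_adj[OF braid_adj] by (simp flip: m_assoc)
next
  case (braid_far i j w)
  then show ?case using gen_far[OF braid_far] by (simp flip: m_assoc)
qed simp_all

end

text \<open>The Garside element: moving a generator past it exchanges \<open>Sig1\<close> with
  \<open>Sig3\<close> and fixes \<open>Sig2\<close>, so its square is central.\<close>

abbreviation half_twist :: "braid_gen list" where
  "half_twist \<equiv> [Sig1, Sig2, Sig1, Sig3, Sig2, Sig1]"

abbreviation full_twist :: "braid_gen list" where
  "full_twist \<equiv> half_twist @ half_twist"

lemmas braid_steps = braid_Cons braid_adj braid_far adj_def

lemma half_twist_Sig1: "half_twist @ Sig1 # w \<sim> Sig3 # half_twist @ w"
proof -
  have "Sig3 # half_twist @ w \<sim> Sig1 # Sig3 # Sig2 # Sig1 # Sig3 # Sig2 # Sig1 # w"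
    by (simp add: braid_steps)
  also have "\<dots> \<sim> Sig1 # Sig3 # Sig2 # Sig3 # Sig1 # Sig2 # Sig1 # w"
    by (simp add: braid_steps)
  also have "\<dots> \<sim> Sig1 # Sig2 # Sig3 # Sig2 # Sig1 # Sig2 # Sig1 # w"
    by (simp add: braid_steps)
  also have "\<dots> \<sim> Sig1 # Sig2 # Sig3 # Sig1 # Sig2 # Sig1 # Sig1 # w"
    by (simp add: braid_steps)
  also have "\<dots> \<sim> Sig1 # Sig2 # Sig1 # Sig3 # Sig2 # Sig1 # Sig1 # w"
    by (simp add: braid_steps)
  finally show ?thesis by (simp add: braid_sym)
qed

lemma half_twist_Sig3: "half_twist @ Sig3 # w \<sim> Sig1 # half_twist @ w"
proof -
  have "Sig1 # half_twist @ w \<sim> Sig1 # Sig2 # Sig1 # Sig2 # Sig3 # Sig2 # Sig1 # w"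
    by (simp add: braid_steps)
  also have "\<dots> \<sim> Sig1 # Sig2 # Sig1 # Sig3 # Sig2 # Sig3 # Sig1 # w"
    by (simp add: braid_steps)
  also have "\<dots> \<sim> Sig1 # Sig2 # Sig1 # Sig3 # Sig2 # Sig1 # Sig3 # w"
    by (simp add: braid_steps)
  finally show ?thesis by (simp add: braid_sym)
qed

lemma half_twist_Sig2: "half_twist @ Sig2 # w \<sim> Sig2 # half_twist @ w"
proof -
  have "half_twist @ Sig2 # w \<sim> Sig1 # Sig2 # Sig1 # Sig3 # Sig1 # Sig2 # Sig1 # w"
    by (simp add: braid_steps)
  also have "\<dots> \<sim> Sig1 # Sig2 # Sig1 # Sig1 # Sig3 # Sig2 # Sig1 # w"
    by (simp add: braid_steps)
  also have "\<dots> \<sim> Sig2 # Sig1 # Sig2 # Sig1 # Sig3 # Sig2 # Sig1 # w"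
    by (simp add: braid_steps)
  finally show ?thesis by simp
qed

lemma full_twist_central: "full_twist @ i # w \<sim> i # full_twist @ w"
proof -
  obtain j where j: "\<And>w. half_twist @ i # w \<sim> j # half_twist @ w"
    "\<And>w. half_twist @ j # w \<sim> i # half_twist @ w"
    using half_twist_Sig1 half_twist_Sig2 half_twist_Sig3 by (cases i) blast+
  have "half_twist @ half_twist @ i # w \<sim> half_twist @ j # half_twist @ w"
    using j(1) by (simp add: braid_Cons)
  also have "\<dots> \<sim> i # half_twist @ half_twist @ w" by (rule j(2))
  finally show ?thesis by simp
qed

text \<open>No quotient is exhibited; the vanishing of the coordinate in the divisibility criterion
  is computed.\<close>

lemma full_twist_starts_with: "\<exists>c. full_twist \<sim> i # c"
  by (rule lk_pos_starts_with) (cases i; simp)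

context braid4
begin

abbreviation twist :: 'a where "twist \<equiv> eval_word full_twist"

lemma twist_commute_word: "twist \<otimes> eval_word w = eval_word w \<otimes> twist"
proof (induction w)
  case (Cons i w)
  have "twist \<otimes> \<sigma> i = \<sigma> i \<otimes> twist"
    using eval_word_braid_eq[OF full_twist_central[of i "[]"]] by (simp add: m_assoc)
  then have "twist \<otimes> (\<sigma> i \<otimes> eval_word w) = \<sigma> i \<otimes> (twist \<otimes> eval_word w)"
    by (metis eval_word_closed gen_closed m_assoc)
  then show ?case using Cons.IH by (metis eval_word_closed eval_word_simps(2) gen_closed m_assoc)
qed simp

lemma twist_pow_eq_word: "twist [^] (k::nat) = eval_word (concat (replicate k full_twist))"
proof (induction k)
  case (Suc k)
  have "twist [^] Suc k = twist \<otimes> eval_word (concat (replicate k full_twist))"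
    using Suc twist_commute_word by (simp del: eval_word_simps)
  then show ?case by (simp only: replicate_Suc concat.simps eval_word_append)
qed simp

lemma twist_pow_commute_word:
  "twist [^] (k::nat) \<otimes> eval_word w = eval_word w \<otimes> twist [^] k"
proof (induction k)
  case (Suc k)
  have cl: "twist \<in> carrier G" "eval_word w \<in> carrier G" by (rule eval_word_closed)+
  note [simp del] = eval_word_simps
  have "twist [^] Suc k \<otimes> eval_word w = twist [^] k \<otimes> (twist \<otimes> eval_word w)"
    using cl by (simp add: m_assoc)
  also have "\<dots> = twist [^] k \<otimes> eval_word w \<otimes> twist"
    using cl twist_commute_word by (simp add: m_assoc)
  also have "\<dots> = eval_word w \<otimes> twist [^] Suc k"
    using cl Suc by (simp add: m_assoc)
  finally show ?case .
qed simp

text \<open>Garside's fractions. The full twist is central and divisible by each generator, so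
  multiplying the inverse of a generator by it gives a positive word; centrality collects the
  denominators of a product.\<close>

lemma generate_fraction:
  "g \<in> generate G (range \<sigma>) \<Longrightarrow> \<exists>(k::nat) u. twist [^] k \<otimes> g = eval_word u"
proof (induction rule: generate.induct)
  case one
  show ?case by (rule exI[of _ 0], rule exI[of _ "[]"]) simp
next
  case (incl g)
  then obtain i where "g = \<sigma> i" by blast
  then show ?case by (intro exI[of _ 0] exI[of _ "[i]"]) simp
next
  case (inv g)
  then obtain i where i: "g = \<sigma> i" by blast
  obtain c where "full_twist \<sim> i # c" using full_twist_starts_with by blast
  then have "twist = \<sigma> i \<otimes> eval_word c"
    using eval_word_braid_eq by fastforce
  moreover have "\<sigma> i \<otimes> twist = twist \<otimes> \<sigma> i"
    using twist_commute_word[of "[i]"] by simp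
  ultimately have "\<sigma> i \<otimes> (eval_word c \<otimes> \<sigma> i) = \<sigma> i \<otimes> twist"
    by (simp add: m_assoc del: append.simps)
  then have "eval_word c \<otimes> \<sigma> i = twist"
    by (simp add: Units_eq del: append.simps eval_word_simps)
  then have "twist \<otimes> inv g = eval_word c"
    using i by (simp add: inv_solve_right' del: append.simps eval_word_simps)
  then show ?case by (intro exI[of _ 1] exI[of _ c]) (simp del: append.simps eval_word_simps)
next
  case (eng g h)
  have "range \<sigma> \<subseteq> carrier G" by auto
  then have cl: "g \<in> carrier G" "h \<in> carrier G" "twist \<in> carrier G"
    using eng generate_in_carrier by auto
  obtain k l :: nat and u v where
    u: "twist [^] k \<otimes> g = eval_word u" and v: "twist [^] l \<otimes> h = eval_word v"
    using eng by blast
  define z where "z = twist"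
  note cl = cl[folded z_def] and u = u[folded z_def] and v = v[folded z_def]
  have "z [^] (l + k) \<otimes> (g \<otimes> h) = z [^] l \<otimes> (z [^] k \<otimes> g) \<otimes> h"
    using cl by (simp add: m_assoc flip: nat_pow_mult)
  also have "\<dots> = eval_word u \<otimes> (z [^] l \<otimes> h)"
    using cl twist_pow_commute_word[of l u, folded z_def] by (simp add: u m_assoc[symmetric])
  also have "\<dots> = eval_word (u @ v)"
    by (simp add: v eval_word_append)
  finally show ?case unfolding z_def by blast
qed

end

text \<open>Write \<open>g\<close> as a positive word over a power of the full twist. If
  \<open>g\<close> dies in \<open>G\<close>, numerator and denominator have equal values there,
  hence are braid equivalent by faithfulness, hence are equal in \<Gamma> as well.\<close>

lemma braid_kernel_trivial:
  assumes "braid4 \<Gamma> \<tau>" "braid4 G \<sigma>" and \<pi>: "\<pi> \<in> hom \<Gamma> G" and gens: "\<And>i. \<pi> (\<tau> i) = \<sigma> i"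
    and faithful: "\<And>u v. braid4.eval_word G \<sigma> u = braid4.eval_word G \<sigma> v \<Longrightarrow> u \<sim> v"
    and g: "g \<in> generate \<Gamma> (range \<tau>)" "\<pi> g = \<one>\<^bsub>G\<^esub>"
  shows "g = \<one>\<^bsub>\<Gamma>\<^esub>"
proof -
  interpret \<Gamma>: braid4 \<Gamma> \<tau> by fact
  interpret G: braid4 G \<sigma> by fact
  have \<pi>_word: "\<pi> (\<Gamma>.eval_word w) = G.eval_word w" for w
    using gens by (induction w) (simp_all add: hom_mult[OF \<pi>] hom_one[OF \<pi> \<Gamma>.is_group G.is_group])
  have g_cl: "g \<in> carrier \<Gamma>" using g \<Gamma>.generate_in_carrier by (metis \<Gamma>.gen_closed image_subsetI)
  obtain k u where u: "\<Gamma>.twist [^]\<^bsub>\<Gamma>\<^esub> (k::nat) \<otimes>\<^bsub>\<Gamma>\<^esub> g = \<Gamma>.eval_word u"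
    using \<Gamma>.generate_fraction g by blast
  let ?z = "concat (replicate k full_twist)"
  have z: "\<Gamma>.eval_word ?z \<otimes>\<^bsub>\<Gamma>\<^esub> g = \<Gamma>.eval_word u"
    using u by (simp only: \<Gamma>.twist_pow_eq_word)
  then have "G.eval_word ?z = G.eval_word u"
    using \<pi>_word hom_mult[OF \<pi> \<Gamma>.eval_word_closed g_cl] g(2) by (metis G.eval_word_closed G.r_one)
  then have "\<Gamma>.eval_word ?z = \<Gamma>.eval_word u" using faithful \<Gamma>.eval_word_braid_eq by blast
  then show ?thesis using z g_cl \<Gamma>.l_cancel_one[OF \<Gamma>.eval_word_closed g_cl] by simp
qed

definition lk_mat :: "real \<Rightarrow> braid_gen \<Rightarrow> real ^ root ^ root" where
  "lk_mat s i = matrix (lk s i)"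

lemma lk_mat_mult: "lk_mat s i *v x = lk s i x"
  unfolding lk_mat_def by (rule matrix_works[OF linear_lk[unfolded linear_matrix_vector_mul_eq[symmetric]]])

lemma braid4_lk:
  assumes "s \<noteq> 0"
  shows "braid4 matrix_group (lk_mat s)"
proof -
  interpret group "matrix_group :: (real ^ root ^ root) monoid" by (rule group_matrix_group)
  show ?thesis
  proof
    show "lk_mat s i \<in> carrier matrix_group" for i
      using lk_eq_0[OF assms] by (simp add: invertible_left_inverse matrix_left_invertible_ker lk_mat_mult)
    fix i j
    show "lk_mat s i \<otimes>\<^bsub>matrix_group\<^esub> lk_mat s j \<otimes>\<^bsub>matrix_group\<^esub> lk_mat s i
        = lk_mat s j \<otimes>\<^bsub>matrix_group\<^esub> lk_mat s i \<otimes>\<^bsub>matrix_group\<^esub> lk_mat s j" if "adj i j"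
      by (simp add: matrix_eq lk_mat_mult flip: matrix_vector_mul_assoc) (intro allI lk_adj that)
    show "lk_mat s i \<otimes>\<^bsub>matrix_group\<^esub> lk_mat s j
        = lk_mat s j \<otimes>\<^bsub>matrix_group\<^esub> lk_mat s i" if "\<not> adj i j"
      by (simp add: matrix_eq lk_mat_mult flip: matrix_vector_mul_assoc) (intro allI lk_far that)
  qed
qed

lemma lk_mat_faithful:
  assumes s: "\<forall>p::int poly. poly (map_poly of_int p) s = 0 \<longrightarrow> p = 0" "s \<noteq> 0"
    and eq: "braid4.eval_word matrix_group (lk_mat s) u = braid4.eval_word matrix_group (lk_mat s) v"
  shows "u \<sim> v"
proof -
  interpret braid4 matrix_group "lk_mat s" by (rule braid4_lk[OF s(2)])
  have "eval_word w *v x = foldr (lk s) w x" for w x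
    by (induction w) (simp_all add: lk_mat_mult flip: matrix_vector_mul_assoc)
  then show ?thesis using eq lk_faithful_on_words[OF s(1)] by metis
qed

section \<open>Automorphisms of the free group of rank two\<close>

abbreviation gen_x :: "nat letter list" where "gen_x \<equiv> [(0, True)]"
abbreviation gen_y :: "nat letter list" where "gen_y \<equiv> [(Suc 0, True)]"
abbreviation inv_x :: "nat letter list" where "inv_x \<equiv> [(0, False)]"

lemma (in group) cancel_left [simp]:
  "x \<in> carrier G \<Longrightarrow> y \<in> carrier G \<Longrightarrow> inv x \<otimes> (x \<otimes> y) = y"
  "x \<in> carrier G \<Longrightarrow> y \<in> carrier G \<Longrightarrow> x \<otimes> (inv x \<otimes> y) = y"
  by (simp_all flip: m_assoc)

lemma (in group) conjugation_hom:
  assumes h: "h \<in> hom H G" and c: "c \<in> carrier G"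
  shows "(\<lambda>w. c \<otimes> h w \<otimes> inv c) \<in> hom H G"
  using c hom_in_carrier[OF h] hom_mult[OF h] by (intro homI) (simp_all add: m_assoc)

lemma (in group) word_val_in_generate:
  assumes f: "f \<in> X \<rightarrow> carrier G" and w: "w \<in> lists (X \<times> UNIV)"
  shows "word_val G f w \<in> generate G (f ` X)"
  using w
proof (induction w)
  case Nil
  then show ?case by (simp add: word_val_def generate.one)
next
  case (Cons a w)
  then have "letter_val G f a \<in> generate G (f ` X)"
    by (auto simp: letter_val_def intro: generate.incl generate.inv)
  then show ?case using Cons.IH by (simp add: word_val_def generate.eng)
qed

lemma hom_F2_eqI:
  assumes "group G" "h \<in> hom F2 G" "k \<in> hom F2 G" "h gen_x = k gen_x" "h gen_y = k gen_y"
    and w: "w \<in> carrier F2"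
  shows "h w = k w"
proof -
  interpret group G by fact
  have "h [(i, True)] = k [(i, True)]" if "i \<in> {..<2}" for i
    using assms(4,5) that by (auto simp: less_2_cases_iff)
  then have "h w = word_val G (\<lambda>i. k [(i, True)]) w"
    by (rule hom_free_group_eq_word_val[OF assms(2) _ w])
  also have "\<dots> = k w"
    by (rule hom_free_group_eq_word_val[OF assms(3) refl w, symmetric])
  finally show ?thesis .
qed

definition endo :: "nat letter list \<Rightarrow> nat letter list \<Rightarrow> nat letter list \<Rightarrow> nat letter list" where
  "endo u v = word_val F2 (\<lambda>i. if i = 0 then u else v)"

lemma endo_hom: "u \<in> carrier F2 \<Longrightarrow> v \<in> carrier F2 \<Longrightarrow> endo u v \<in> hom F2 F2"
  unfolding endo_def by (rule group.word_val_hom[OF group_free_group]) auto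

lemma endo_closed:
  "u \<in> carrier F2 \<Longrightarrow> v \<in> carrier F2 \<Longrightarrow> w \<in> carrier F2 \<Longrightarrow> endo u v w \<in> carrier F2"
  by (rule hom_in_carrier[OF endo_hom])

lemma endo_Nil [simp]: "endo u v [] = []"
  by (simp add: endo_def word_val_def free_group_simps)

lemma endo_Cons:
  assumes "u \<in> carrier F2" "v \<in> carrier F2"
  shows "endo u v ((i, s) # w) = foldr push ((if s then id else inv_word) (if i = 0 then u else v)) (endo u v w)"
  using assms by (simp add: endo_def word_val_def letter_val_def inv_free_group free_group_simps)

lemma endo_gen [simp]:
  assumes "u \<in> carrier F2" "v \<in> carrier F2"
  shows "endo u v gen_x = u" "endo u v [(Suc 0, True)] = v"
  using endo_Cons[OF assms, of _ True "[]"] assms[THEN carrier_free_groupD(1)]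
  by (simp_all add: foldr_push_Nil)

lemma endo_basis:
  assumes "w \<in> carrier F2" shows "endo gen_x gen_y w = w"
proof -
  have "(\<lambda>w. w) \<in> hom F2 F2" by (simp add: hom_def)
  moreover have "gen_x \<in> carrier F2" "gen_y \<in> carrier F2" by (auto simp: free_group_def reduced_Cons)
  ultimately show ?thesis
    using assms hom_F2_eqI[OF group_free_group endo_hom, of gen_x gen_y "\<lambda>w. w"] by simp
qed

lemma endo_endo:
  assumes uv: "u \<in> carrier F2" "v \<in> carrier F2" and ab: "a \<in> carrier F2" "b \<in> carrier F2"
    and w: "w \<in> carrier F2"
  shows "endo u v (endo a b w) = endo (endo u v a) (endo u v b) w"
proof -
  have "endo u v \<circ> endo a b \<in> hom F2 F2" by (rule hom_compose[OF endo_hom[OF ab] endo_hom[OF uv]])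
  moreover have "endo (endo u v a) (endo u v b) \<in> hom F2 F2" using assms by (intro endo_hom endo_closed)
  ultimately have "(endo u v \<circ> endo a b) w = endo (endo u v a) (endo u v b) w"
    by (rule hom_F2_eqI[OF group_free_group _ _ _ _ w]) (simp_all add: assms endo_closed)
  then show ?thesis by simp
qed

text \<open>Here \<open>a # g\<close> is reduced as it stands. If it equalled the product of
  \<open>g\<close> and \<open>a\<close>, the lengths would rule out cancellation there too, and
  \<open>g\<close> would start with \<open>a\<close>.\<close>

lemma commutes_with_letter:
  assumes "reduced g" "g \<noteq> []" "fst a \<noteq> fst (hd g)"
  shows "foldr push g [a] \<noteq> foldr push [a] g"
proof
  assume eq: "foldr push g [a] = foldr push [a] g"
  have "hd g \<noteq> flip a" using assms(3) by (metis fst_flip)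
  then have push: "foldr push [a] g = a # g" using assms(2) by (cases g) auto
  obtain p s q where d: "g = p @ s" "[a] = inv_word s @ q" "foldr push g [a] = p @ q"
    using foldr_push_decompose[OF assms(1), of "[a]"] by (auto simp: reduced_Cons)
  have "length s + length q = 1" using arg_cong[OF d(2), of length] by simp
  moreover have "length p + length q = Suc (length p + length s)"
    using arg_cong[OF trans[OF d(3)[symmetric] trans[OF eq push]], of length] d(1) by simp
  ultimately have "s = []" by simp
  then have "g @ q = a # g" using d eq push by simp
  then have "hd g = a" using assms(2) by (metis hd_append2 list.sel(1))
  then show False using assms(3) by simp
qed

lemma F2_center_trivial:
  assumes "g \<in> carrier F2" "foldr push g gen_x = foldr push gen_x g" "foldr push g gen_y = foldr push gen_y g"
  shows "g = []"
proof (rule ccontr)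
  assume "g \<noteq> []"
  then show False
    using commutes_with_letter[of g "(0, True)"] commutes_with_letter[of g "(Suc 0, True)"] assms
      carrier_free_groupD(1)[OF assms(1)] by (cases "fst (hd g) = 0") auto
qed

lemma AutoGroup_simps:
  "carrier (AutoGroup G) = auto G" "\<one>\<^bsub>AutoGroup G\<^esub> = (\<lambda>w \<in> carrier G. w)"
  by (simp_all add: AutoGroup_def BijGroup_def)

lemma AutoGroup_mult_apply:
  assumes "a \<in> auto G" "b \<in> auto G" "w \<in> carrier G"
  shows "(a \<otimes>\<^bsub>AutoGroup G\<^esub> b) w = a (b w)"
  using assms by (simp add: AutoGroup_def BijGroup_def auto_def compose_def)

lemma auto_F2_eqI:
  assumes "a \<in> auto F2" "b \<in> auto F2" "a gen_x = b gen_x" "a gen_y = b gen_y"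
  shows "a = b"
proof (rule extensionalityI[where A = "carrier F2"])
  show "a \<in> extensional (carrier F2)" "b \<in> extensional (carrier F2)"
    using assms by (auto simp: auto_def Bij_imp_extensional)
  show "a w = b w" if "w \<in> carrier F2" for w
    by (rule hom_F2_eqI[OF group_free_group _ _ _ _ that]) (use assms in \<open>auto simp: auto_def\<close>)
qed

lemma (in group) restrict_in_auto:
  assumes h: "h \<in> hom G G" and bij: "bij_betw h (carrier G) (carrier G)"
  shows "restrict h (carrier G) \<in> auto G"
proof -
  have "bij_betw (restrict h (carrier G)) (carrier G) (carrier G)"
    using bij bij_betw_cong[of "carrier G" "restrict h (carrier G)" h] by simp
  moreover have "restrict h (carrier G) \<in> hom G G"
    using hom_in_carrier[OF h] hom_mult[OF h] by (intro homI) simp_all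
  ultimately show ?thesis by (simp add: auto_def Bij_def)
qed

lemma endo_auto:
  assumes uv: "u \<in> carrier F2" "v \<in> carrier F2" and uv': "u' \<in> carrier F2" "v' \<in> carrier F2"
    and "endo u v u' = gen_x" "endo u v v' = gen_y" "endo u' v' u = gen_x" "endo u' v' v = gen_y"
  shows "restrict (endo u v) (carrier F2) \<in> auto F2"
proof -
  have "bij_betw (endo u v) (carrier F2) (carrier F2)"
    by (rule bij_betw_byWitness[where f' = "endo u' v'"])
      (use assms in \<open>auto simp: endo_endo endo_basis endo_closed\<close>)
  then show ?thesis by (rule group.restrict_in_auto[OF group_free_group endo_hom[OF uv]])
qed

text \<open>The action of \<open>B\<^sub>4\<close> by conjugation on its normal subgroup freely generated by \<open>x = \<sigma>\<^sub>1 \<sigma>\<^sub>3\<^sup>-\<^sup>1\<close>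
  and \<open>y = \<sigma>\<^sub>2 \<sigma>\<^sub>1 \<sigma>\<^sub>3\<^sup>-\<^sup>1 \<sigma>\<^sub>2\<^sup>-\<^sup>1\<close>.\<close>

fun braid_auto :: "braid_gen \<Rightarrow> nat letter list \<Rightarrow> nat letter list" where
  "braid_auto Sig1 = endo gen_x [(Suc 0, True), (0, False)]"
| "braid_auto Sig2 = endo gen_y [(Suc 0, True), (0, False), (Suc 0, True)]"
| "braid_auto Sig3 = endo gen_x [(0, False), (Suc 0, True)]"

lemma concrete_word_in_F2:
  "w \<in> carrier F2 \<longleftrightarrow> (\<forall>(i, s) \<in> set w. i < 2) \<and> reduced w"
  by (auto simp: free_group_def)

lemmas word_calc = concrete_word_in_F2 reduced_Cons flip_def endo_Cons inv_word_Cons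

lemma braid_auto_in_auto: "restrict (braid_auto i) (carrier F2) \<in> auto F2"
proof (cases i)
  case Sig1
  then show ?thesis
    using endo_auto[of gen_x "[(Suc 0, True), (0, False)]" gen_x "[(Suc 0, True), (0, True)]"]
    by (simp add: word_calc)
next
  case Sig2
  then show ?thesis
    using endo_auto[of gen_y "[(Suc 0, True), (0, False), (Suc 0, True)]" "[(0, True), (Suc 0, False), (0, True)]" gen_x]
    by (simp add: word_calc)
next
  case Sig3
  then show ?thesis
    using endo_auto[of gen_x "[(0, False), (Suc 0, True)]" gen_x "[(0, True), (Suc 0, True)]"]
    by (simp add: word_calc)
qed

lemma group_AutoGroup_F2: "group (AutoGroup F2)"
  by (rule group.AutoGroup[OF group_free_group])

lemma braid_auto_closed: "w \<in> carrier F2 \<Longrightarrow> braid_auto i w \<in> carrier F2"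
  using braid_auto_in_auto[of i] by (auto simp: auto_def dest: hom_in_carrier)

text \<open>\<open>AutoGroup\<close> consists of functions that are \<open>undefined\<close> outside
  the carrier, hence the restriction.\<close>

abbreviation baut :: "braid_gen \<Rightarrow> nat letter list \<Rightarrow> nat letter list" where
  "baut i \<equiv> restrict (braid_auto i) (carrier F2)"

lemma gens_in_F2 [simp]: "gen_x \<in> carrier F2" "[(Suc 0, True)] \<in> carrier F2"
  by (simp_all add: word_calc)

lemma braid4_AutoGroup: "braid4 (AutoGroup F2) baut"
proof -
  interpret A: group "AutoGroup F2" by (rule group_AutoGroup_F2)
  have mult_closed: "a \<otimes>\<^bsub>AutoGroup F2\<^esub> b \<in> auto F2" if "a \<in> auto F2" "b \<in> auto F2" for a b
    using A.m_closed that by (simp add: AutoGroup_simps)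
  show ?thesis
  proof
    fix i j
    show "baut i \<in> carrier (AutoGroup F2)" by (simp add: AutoGroup_simps braid_auto_in_auto)
    show "baut i \<otimes>\<^bsub>AutoGroup F2\<^esub> baut j \<otimes>\<^bsub>AutoGroup F2\<^esub> baut i
        = baut j \<otimes>\<^bsub>AutoGroup F2\<^esub> baut i \<otimes>\<^bsub>AutoGroup F2\<^esub> baut j" if "adj i j"
    proof (rule auto_F2_eqI)
      have "braid_auto i (braid_auto j (braid_auto i gen_x)) = braid_auto j (braid_auto i (braid_auto j gen_x))"
        "braid_auto i (braid_auto j (braid_auto i gen_y)) = braid_auto j (braid_auto i (braid_auto j gen_y))"
        using that by (cases i; cases j; simp add: adj_def word_calc)+
      then show "(baut i \<otimes>\<^bsub>AutoGroup F2\<^esub> baut j \<otimes>\<^bsub>AutoGroup F2\<^esub> baut i) gen_x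
          = (baut j \<otimes>\<^bsub>AutoGroup F2\<^esub> baut i \<otimes>\<^bsub>AutoGroup F2\<^esub> baut j) gen_x"
        "(baut i \<otimes>\<^bsub>AutoGroup F2\<^esub> baut j \<otimes>\<^bsub>AutoGroup F2\<^esub> baut i) gen_y
          = (baut j \<otimes>\<^bsub>AutoGroup F2\<^esub> baut i \<otimes>\<^bsub>AutoGroup F2\<^esub> baut j) gen_y"
        by (simp_all add: mult_closed braid_auto_in_auto AutoGroup_mult_apply braid_auto_closed)
    qed (simp_all add: mult_closed braid_auto_in_auto)
    show "baut i \<otimes>\<^bsub>AutoGroup F2\<^esub> baut j = baut j \<otimes>\<^bsub>AutoGroup F2\<^esub> baut i" if "\<not> adj i j"
    proof (rule auto_F2_eqI)
      have "braid_auto i (braid_auto j gen_x) = braid_auto j (braid_auto i gen_x)"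
        "braid_auto i (braid_auto j gen_y) = braid_auto j (braid_auto i gen_y)"
        using that by (cases i; cases j; simp add: adj_def word_calc)+
      then show "(baut i \<otimes>\<^bsub>AutoGroup F2\<^esub> baut j) gen_x = (baut j \<otimes>\<^bsub>AutoGroup F2\<^esub> baut i) gen_x"
        "(baut i \<otimes>\<^bsub>AutoGroup F2\<^esub> baut j) gen_y = (baut j \<otimes>\<^bsub>AutoGroup F2\<^esub> baut i) gen_y"
        by (simp_all add: mult_closed braid_auto_in_auto AutoGroup_mult_apply braid_auto_closed)
    qed (simp_all add: mult_closed braid_auto_in_auto)
  qed
qed

definition inner_by :: "nat letter list \<Rightarrow> nat letter list \<Rightarrow> nat letter list" where
  "inner_by g = (\<lambda>w \<in> carrier F2. g \<otimes>\<^bsub>F2\<^esub> w \<otimes>\<^bsub>F2\<^esub> inv\<^bsub>F2\<^esub> g)"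

lemma inner_by_auto: "g \<in> carrier F2 \<Longrightarrow> inner_by g \<in> auto F2"
proof -
  assume g: "g \<in> carrier F2"
  interpret F: group F2 by (rule group_free_group)
  have "bij_betw (\<lambda>w. g \<otimes>\<^bsub>F2\<^esub> w \<otimes>\<^bsub>F2\<^esub> inv\<^bsub>F2\<^esub> g) (carrier F2) (carrier F2)"
    by (rule bij_betw_byWitness[where f' = "\<lambda>w. inv\<^bsub>F2\<^esub> g \<otimes>\<^bsub>F2\<^esub> w \<otimes>\<^bsub>F2\<^esub> g"])
      (use g in \<open>auto simp: F.m_assoc\<close>)
  moreover have "(\<lambda>w. g \<otimes>\<^bsub>F2\<^esub> w \<otimes>\<^bsub>F2\<^esub> inv\<^bsub>F2\<^esub> g) \<in> hom F2 F2"
    using F.conjugation_hom[of "\<lambda>w. w" F2 g] g by (simp add: hom_def)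
  ultimately show ?thesis unfolding inner_by_def by (intro F.restrict_in_auto)
qed

lemma inner_by_hom: "inner_by \<in> hom F2 (AutoGroup F2)"
proof (rule homI)
  interpret F: group F2 by (rule group_free_group)
  interpret A: group "AutoGroup F2" by (rule group_AutoGroup_F2)
  show "inner_by g \<in> carrier (AutoGroup F2)" if "g \<in> carrier F2" for g
    using that by (simp add: AutoGroup_simps inner_by_auto)
  show "inner_by (g \<otimes>\<^bsub>F2\<^esub> h) = inner_by g \<otimes>\<^bsub>AutoGroup F2\<^esub> inner_by h"
    if g: "g \<in> carrier F2" and h: "h \<in> carrier F2" for g h
  proof (rule auto_F2_eqI)
    show "inner_by g \<otimes>\<^bsub>AutoGroup F2\<^esub> inner_by h \<in> auto F2"
      using A.m_closed[of "inner_by g" "inner_by h"] g h by (simp add: AutoGroup_simps inner_by_auto)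
    have "inner_by (g \<otimes>\<^bsub>F2\<^esub> h) w = (inner_by g \<otimes>\<^bsub>AutoGroup F2\<^esub> inner_by h) w" if "w \<in> carrier F2" for w
      using that g h by (simp add: AutoGroup_mult_apply inner_by_auto) (simp add: inner_by_def F.inv_mult_group F.m_assoc)
    then show "inner_by (g \<otimes>\<^bsub>F2\<^esub> h) gen_x = (inner_by g \<otimes>\<^bsub>AutoGroup F2\<^esub> inner_by h) gen_x"
      "inner_by (g \<otimes>\<^bsub>F2\<^esub> h) gen_y = (inner_by g \<otimes>\<^bsub>AutoGroup F2\<^esub> inner_by h) gen_y"
      by simp_all
  qed (use g h in \<open>simp add: inner_by_auto\<close>)
qed

lemma inner_by_eq_one:
  assumes "g \<in> carrier F2" "inner_by g = \<one>\<^bsub>AutoGroup F2\<^esub>"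
  shows "g = []"
proof (rule F2_center_trivial[OF assms(1)])
  interpret F: group F2 by (rule group_free_group)
  have "g \<otimes>\<^bsub>F2\<^esub> w = w \<otimes>\<^bsub>F2\<^esub> g" if "w \<in> carrier F2" for w
    using fun_cong[OF assms(2), of w] that assms(1)
    by (simp add: inner_by_def AutoGroup_simps F.inv_solve_right')
  from this[of gen_x] this[of gen_y] show "foldr push g gen_x = foldr push gen_x g"
    "foldr push g gen_y = foldr push gen_y g"
    by (simp_all add: free_group_simps del: foldr.simps)
qed

section \<open>The free normal subgroup of the braid group\<close>

context braid4
begin

definition free_gen :: "nat \<Rightarrow> 'a" where
  "free_gen i = (if i = 0 then \<sigma> Sig1 \<otimes> inv \<sigma> Sig3
     else \<sigma> Sig2 \<otimes> (\<sigma> Sig1 \<otimes> inv \<sigma> Sig3) \<otimes> inv \<sigma> Sig2)"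

definition embed :: "nat letter list \<Rightarrow> 'a" where
  "embed = word_val G free_gen"

lemma free_gen_closed: "free_gen \<in> {..<2} \<rightarrow> carrier G"
  by (auto simp: free_gen_def)

lemma embed_hom: "embed \<in> hom F2 G"
  unfolding embed_def by (rule word_val_hom[OF free_gen_closed])

lemma embed_closed [simp]: "w \<in> carrier F2 \<Longrightarrow> embed w \<in> carrier G"
  by (rule hom_in_carrier[OF embed_hom])

lemma embed_gens:
  "embed gen_x = \<sigma> Sig1 \<otimes> inv \<sigma> Sig3"
  "embed gen_y = \<sigma> Sig2 \<otimes> (\<sigma> Sig1 \<otimes> inv \<sigma> Sig3) \<otimes> inv \<sigma> Sig2"
  by (simp_all add: embed_def word_val_def letter_val_def free_gen_def)

lemma embed_in_generate: "w \<in> carrier F2 \<Longrightarrow> embed w \<in> generate G (range \<sigma>)"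
proof -
  assume w: "w \<in> carrier F2"
  have gens: "\<sigma> i \<in> generate G (range \<sigma>)" "inv \<sigma> i \<in> generate G (range \<sigma>)" for i
    by (simp_all add: generate.incl generate.inv)
  have "free_gen ` {..<2} \<subseteq> generate G (range \<sigma>)"
    by (auto simp: free_gen_def intro!: generate.eng gens)
  then have "generate G (free_gen ` {..<2}) \<subseteq> generate G (range \<sigma>)"
    by (intro generate_subgroup_incl generate_is_subgroup) auto
  then show ?thesis
    using word_val_in_generate[OF free_gen_closed carrier_free_groupD(2)[OF w]]
    unfolding embed_def by blast
qed

text \<open>The tail \<open>t\<close> lets this relation and the next ones rewrite inside
  right-nested products.\<close>

lemma braid_121:
  assumes "t \<in> carrier G"
  shows "\<sigma> Sig1 \<otimes> (\<sigma> Sig2 \<otimes> (\<sigma> Sig1 \<otimes> t)) = \<sigma> Sig2 \<otimes> (\<sigma> Sig1 \<otimes> (\<sigma> Sig2 \<otimes> t))"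
  using gen_adj[of Sig1 Sig2] assms by (simp add: adj_def flip: m_assoc)

lemma braid_323:
  assumes "t \<in> carrier G"
  shows "\<sigma> Sig3 \<otimes> (\<sigma> Sig2 \<otimes> (\<sigma> Sig3 \<otimes> t)) = \<sigma> Sig2 \<otimes> (\<sigma> Sig3 \<otimes> (\<sigma> Sig2 \<otimes> t))"
  using gen_adj[of Sig3 Sig2] assms by (simp add: adj_def flip: m_assoc)

lemma braid_31:
  assumes "t \<in> carrier G"
  shows "\<sigma> Sig3 \<otimes> (\<sigma> Sig1 \<otimes> t) = \<sigma> Sig1 \<otimes> (\<sigma> Sig3 \<otimes> t)"
  using gen_far[of Sig3 Sig1] assms by (simp add: adj_def flip: m_assoc)

lemma braid_3'1':
  assumes "t \<in> carrier G"
  shows "inv \<sigma> Sig3 \<otimes> (inv \<sigma> Sig1 \<otimes> t) = inv \<sigma> Sig1 \<otimes> (inv \<sigma> Sig3 \<otimes> t)"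
  using arg_cong[OF gen_far[of Sig1 Sig3], of "m_inv G"] assms
  by (simp add: adj_def inv_mult_group flip: m_assoc)

lemma braid_23'2':
  assumes "t \<in> carrier G"
  shows "\<sigma> Sig2 \<otimes> (inv \<sigma> Sig3 \<otimes> (inv \<sigma> Sig2 \<otimes> t)) = inv \<sigma> Sig3 \<otimes> (inv \<sigma> Sig2 \<otimes> (\<sigma> Sig3 \<otimes> t))"
proof -
  let ?r = "inv \<sigma> Sig3 \<otimes> (inv \<sigma> Sig2 \<otimes> t)"
  have "\<sigma> Sig3 \<otimes> (\<sigma> Sig2 \<otimes> (\<sigma> Sig3 \<otimes> ?r)) = \<sigma> Sig2 \<otimes> (\<sigma> Sig3 \<otimes> (\<sigma> Sig2 \<otimes> ?r))"
    using assms by (intro braid_323) simp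
  then have "\<sigma> Sig3 \<otimes> t = \<sigma> Sig2 \<otimes> (\<sigma> Sig3 \<otimes> (\<sigma> Sig2 \<otimes> ?r))"
    using assms by simp
  then show ?thesis using assms by simp
qed

lemma conj_sigma1:
  "\<sigma> Sig1 \<otimes> embed gen_x \<otimes> inv \<sigma> Sig1 = embed gen_x"
  "\<sigma> Sig1 \<otimes> embed gen_y \<otimes> inv \<sigma> Sig1 = embed gen_y \<otimes> inv embed gen_x"
proof -
  show "\<sigma> Sig1 \<otimes> embed gen_x \<otimes> inv \<sigma> Sig1 = embed gen_x"
    using braid_3'1'[of \<one>] by (simp add: embed_gens m_assoc)
  show "\<sigma> Sig1 \<otimes> embed gen_y \<otimes> inv \<sigma> Sig1 = embed gen_y \<otimes> inv embed gen_x"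
    by (simp add: embed_gens m_assoc inv_mult_group braid_121 braid_23'2')
qed

text \<open>The braid inducing the move \<open>rotate\<close>. As \<sigma> \<open>Sig1\<close> and
  \<sigma> \<open>Sig3\<close> commute with the image of the first generator, only \<sigma>
  \<open>Sig2\<close> acts on it, which gives the image of the second.\<close>

definition rotation :: 'a where
  "rotation = \<sigma> Sig2 \<otimes> (\<sigma> Sig1 \<otimes> \<sigma> Sig3)"

lemma rotation_closed [simp]: "rotation \<in> carrier G"
  by (simp add: rotation_def)

lemma conj_rotation:
  "rotation \<otimes> embed gen_x \<otimes> inv rotation = embed gen_y"
  "rotation \<otimes> embed gen_y \<otimes> inv rotation = inv embed gen_x"
proof -
  show "rotation \<otimes> embed gen_x \<otimes> inv rotation = embed gen_y"
    by (simp add: rotation_def embed_gens m_assoc inv_mult_group braid_31 braid_3'1')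
  \<comment> \<open>This is \<open>rotation\<close> times \<sigma> \<open>Sig2\<close>, the factor
    coming from the definition of the second free generator. Conjugation by it exchanges \<sigma>
    \<open>Sig1\<close> and \<sigma> \<open>Sig3\<close>, so it inverts the image of the first
    generator.\<close>
  define \<theta> where "\<theta> = \<sigma> Sig2 \<otimes> (\<sigma> Sig1 \<otimes> (\<sigma> Sig3 \<otimes> \<sigma> Sig2))"
  have \<theta> [simp]: "\<theta> \<in> carrier G" by (simp add: \<theta>_def)
  have "\<theta> \<otimes> \<sigma> Sig1 = \<sigma> Sig3 \<otimes> \<theta>"
  proof -
    have "\<theta> \<otimes> \<sigma> Sig1 = \<sigma> Sig2 \<otimes> (\<sigma> Sig3 \<otimes> (\<sigma> Sig1 \<otimes> (\<sigma> Sig2 \<otimes> (\<sigma> Sig1 \<otimes> \<one>))))"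
      by (simp add: \<theta>_def m_assoc braid_31)
    also have "\<dots> = \<sigma> Sig2 \<otimes> (\<sigma> Sig3 \<otimes> (\<sigma> Sig2 \<otimes> (\<sigma> Sig1 \<otimes> (\<sigma> Sig2 \<otimes> \<one>))))"
      by (subst braid_121) simp_all
    also have "\<dots> = \<sigma> Sig3 \<otimes> (\<sigma> Sig2 \<otimes> (\<sigma> Sig3 \<otimes> (\<sigma> Sig1 \<otimes> (\<sigma> Sig2 \<otimes> \<one>))))"
      by (subst braid_323) simp_all
    also have "\<dots> = \<sigma> Sig3 \<otimes> \<theta>"
      by (simp add: \<theta>_def m_assoc braid_31)
    finally show ?thesis .
  qed
  moreover have "\<theta> \<otimes> \<sigma> Sig3 = \<sigma> Sig1 \<otimes> \<theta>"
  proof -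
    have "\<theta> \<otimes> \<sigma> Sig3 = \<sigma> Sig2 \<otimes> (\<sigma> Sig1 \<otimes> (\<sigma> Sig3 \<otimes> (\<sigma> Sig2 \<otimes> (\<sigma> Sig3 \<otimes> \<one>))))"
      by (simp add: \<theta>_def m_assoc)
    also have "\<dots> = \<sigma> Sig2 \<otimes> (\<sigma> Sig1 \<otimes> (\<sigma> Sig2 \<otimes> (\<sigma> Sig3 \<otimes> (\<sigma> Sig2 \<otimes> \<one>))))"
      by (subst braid_323) simp_all
    also have "\<dots> = \<sigma> Sig1 \<otimes> (\<sigma> Sig2 \<otimes> (\<sigma> Sig1 \<otimes> (\<sigma> Sig3 \<otimes> (\<sigma> Sig2 \<otimes> \<one>))))"
      by (subst braid_121) simp_all
    also have "\<dots> = \<sigma> Sig1 \<otimes> \<theta>" by (simp add: \<theta>_def)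
    finally show ?thesis .
  qed
  from arg_cong[OF this, of "\<lambda>g. inv \<sigma> Sig1 \<otimes> g \<otimes> inv \<sigma> Sig3"]
  have "\<theta> \<otimes> inv \<sigma> Sig3 = inv \<sigma> Sig1 \<otimes> \<theta>"
    by (simp add: m_assoc)
  ultimately have "\<theta> \<otimes> (\<sigma> Sig1 \<otimes> inv \<sigma> Sig3) = \<sigma> Sig3 \<otimes> inv \<sigma> Sig1 \<otimes> \<theta>"
    by (metis \<theta> gen_closed inv_closed m_assoc)
  then have "\<theta> \<otimes> (\<sigma> Sig1 \<otimes> inv \<sigma> Sig3) \<otimes> inv \<theta> = \<sigma> Sig3 \<otimes> inv \<sigma> Sig1"
    by (simp add: m_assoc)
  then show "rotation \<otimes> embed gen_y \<otimes> inv rotation = inv embed gen_x"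
    by (simp add: rotation_def embed_gens \<theta>_def m_assoc inv_mult_group)
qed

end

section \<open>The reflection and its interplay with conjugation by braids\<close>

abbreviation invert_x :: "nat letter list \<Rightarrow> nat letter list" where
  "invert_x \<equiv> endo inv_x gen_y"

lemma inv_x_in_F2 [simp]: "inv_x \<in> carrier F2" "[(Suc 0, True), (0, False)] \<in> carrier F2"
  by (simp_all add: word_calc)

context braid4
begin

lemma inv_embed: "w \<in> carrier F2 \<Longrightarrow> inv embed w = embed (inv_word w)"
  using group_hom.hom_inv[OF group_hom.intro[OF group_free_group is_group group_hom_axioms.intro[OF embed_hom]]]
  by (simp add: inv_free_group)

lemma embed_eqI:
  assumes "h \<in> hom F2 F2" "c \<in> carrier G" "k \<in> hom F2 F2"
    and "embed (h gen_x) = c \<otimes> embed (k gen_x) \<otimes> inv c" "embed (h gen_y) = c \<otimes> embed (k gen_y) \<otimes> inv c"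
    and "w \<in> carrier F2"
  shows "embed (h w) = c \<otimes> embed (k w) \<otimes> inv c"
proof -
  have "embed \<circ> h \<in> hom F2 G" using assms embed_hom by (blast intro: Group.hom_compose)
  moreover have "(\<lambda>w. c \<otimes> (embed \<circ> k) w \<otimes> inv c) \<in> hom F2 G"
    using assms embed_hom by (intro conjugation_hom) (blast intro: Group.hom_compose)+
  ultimately show ?thesis
    using hom_F2_eqI[OF is_group, of "embed \<circ> h" "\<lambda>w. c \<otimes> (embed \<circ> k) w \<otimes> inv c" w] assms(4-6)
    by simp
qed

lemma embed_mult: "u \<in> carrier F2 \<Longrightarrow> v \<in> carrier F2 \<Longrightarrow> embed (foldr push u v) = embed u \<otimes> embed v"
  using hom_mult[OF embed_hom, of u v] by (simp add: free_group_simps)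

lemma id_hom: "(\<lambda>w. w) \<in> hom F2 F2" by (simp add: hom_def)

lemma embed_words:
  "embed inv_x = inv embed gen_x" "embed [(Suc 0, False)] = inv embed gen_y"
  "embed [(Suc 0, True), (0, False)] = embed gen_y \<otimes> inv embed gen_x"
  "embed [(Suc 0, True), (0, True)] = embed gen_y \<otimes> embed gen_x"
  using embed_mult[of gen_y inv_x] embed_mult[of gen_y gen_x] inv_embed[of gen_x] inv_embed[of gen_y]
  by (simp_all add: inv_word_Cons flip_def)

lemma embed_shear:
  "w \<in> carrier F2 \<Longrightarrow> embed (endo gen_x [(Suc 0, True), (0, False)] w) = \<sigma> Sig1 \<otimes> embed w \<otimes> inv \<sigma> Sig1"
  by (rule embed_eqI[OF endo_hom _ id_hom]) (simp_all add: conj_sigma1 embed_words)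

lemma embed_rotate:
  "w \<in> carrier F2 \<Longrightarrow> embed (endo gen_y inv_x w) = rotation \<otimes> embed w \<otimes> inv rotation"
  by (rule embed_eqI[OF endo_hom _ id_hom]) (simp_all add: conj_rotation embed_words)

lemma conj_inverse:
  assumes "c \<in> carrier G" "a \<in> carrier G" "c \<otimes> a \<otimes> inv c = b"
  shows "inv c \<otimes> b \<otimes> inv (inv c) = a"
  using assms(1,2) unfolding assms(3)[symmetric] by (simp add: m_assoc)

lemma invert_x_hom: "invert_x \<in> hom F2 F2"
  by (rule endo_hom) simp_all

text \<open>Conjugating the shear by \<open>invert_x\<close> gives the inverse shear, so the second
  coordinate of \<open>f\<close> is conjugated by the inverse braid. The same holds for the
  rotation.\<close>

lemma embed_invert_x_shear:
  assumes w: "w \<in> carrier F2"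
  shows "embed (invert_x (endo gen_x [(Suc 0, True), (0, False)] w))
    = inv \<sigma> Sig1 \<otimes> embed (invert_x w) \<otimes> inv (inv \<sigma> Sig1)"
proof -
  have x: "inv \<sigma> Sig1 \<otimes> inv embed gen_x \<otimes> inv (inv \<sigma> Sig1) = inv embed gen_x"
    using conj_sigma1(1)[THEN arg_cong[of _ _ "m_inv G"]]
    by (intro conj_inverse) (simp_all add: inv_mult_group m_assoc)
  have "\<sigma> Sig1 \<otimes> (embed gen_y \<otimes> embed gen_x) \<otimes> inv \<sigma> Sig1
      = (\<sigma> Sig1 \<otimes> embed gen_y \<otimes> inv \<sigma> Sig1) \<otimes> (\<sigma> Sig1 \<otimes> embed gen_x \<otimes> inv \<sigma> Sig1)"
    by (simp add: m_assoc)
  also have "\<dots> = embed gen_y" by (simp only: conj_sigma1) (simp add: m_assoc)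
  finally have y: "inv \<sigma> Sig1 \<otimes> embed gen_y \<otimes> inv (inv \<sigma> Sig1) = embed gen_y \<otimes> embed gen_x"
    by (intro conj_inverse) simp_all
  have "embed ((invert_x \<circ> endo gen_x [(Suc 0, True), (0, False)]) w)
    = inv \<sigma> Sig1 \<otimes> embed (invert_x w) \<otimes> inv (inv \<sigma> Sig1)"
  proof (rule embed_eqI[OF Group.hom_compose[OF endo_hom endo_hom] _ invert_x_hom])
    show "embed ((invert_x \<circ> endo gen_x [(Suc 0, True), (0, False)]) gen_x)
        = inv \<sigma> Sig1 \<otimes> embed (invert_x gen_x) \<otimes> inv (inv \<sigma> Sig1)"
      using x by (simp add: embed_words)
    show "embed ((invert_x \<circ> endo gen_x [(Suc 0, True), (0, False)]) gen_y)
        = inv \<sigma> Sig1 \<otimes> embed (invert_x gen_y) \<otimes> inv (inv \<sigma> Sig1)"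
      using y by (simp add: embed_words endo_Cons inv_word_Cons flip_def)
  qed (use w in simp_all)
  then show ?thesis by simp
qed

lemma embed_invert_x_rotate:
  assumes w: "w \<in> carrier F2"
  shows "embed (invert_x (endo gen_y inv_x w))
    = inv rotation \<otimes> embed (invert_x w) \<otimes> inv (inv rotation)"
proof -
  have x: "inv rotation \<otimes> inv embed gen_x \<otimes> inv (inv rotation) = embed gen_y"
    by (intro conj_inverse conj_rotation) simp_all
  have y: "inv rotation \<otimes> embed gen_y \<otimes> inv (inv rotation) = embed gen_x"
    by (intro conj_inverse conj_rotation) simp_all
  have "embed ((invert_x \<circ> endo gen_y inv_x) w)
    = inv rotation \<otimes> embed (invert_x w) \<otimes> inv (inv rotation)"
  proof (rule embed_eqI[OF Group.hom_compose[OF endo_hom endo_hom] _ invert_x_hom])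
    show "embed ((invert_x \<circ> endo gen_y inv_x) gen_x)
        = inv rotation \<otimes> embed (invert_x gen_x) \<otimes> inv (inv rotation)"
      using x by (simp add: embed_words)
    show "embed ((invert_x \<circ> endo gen_y inv_x) gen_y)
        = inv rotation \<otimes> embed (invert_x gen_y) \<otimes> inv (inv rotation)"
      using y by (simp add: embed_words endo_Cons inv_word_Cons flip_def)
  qed (use w in simp_all)
  then show ?thesis by simp
qed

end

text \<open>The braid action restricts on the free subgroup to inner automorphisms:
  \<open>baut Sig1\<close> and \<open>baut Sig3\<close> differ by conjugation with the first
  generator, and \<open>baut Sig2\<close> sends the first generator to the second.\<close>

lemma inner_by_gens:
  "inner_by gen_x = braid4.embed (AutoGroup F2) baut gen_x"
  "inner_by gen_y = braid4.embed (AutoGroup F2) baut gen_y"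
proof -
  interpret A: braid4 "AutoGroup F2" baut by (rule braid4_AutoGroup)
  interpret F: group F2 by (rule group_free_group)
  have inner_cl: "inner_by g \<in> carrier (AutoGroup F2)" if "g \<in> carrier F2" for g
    using that by (simp add: AutoGroup_simps inner_by_auto)
  have mult_closed: "a \<otimes>\<^bsub>AutoGroup F2\<^esub> b \<in> auto F2" if "a \<in> auto F2" "b \<in> auto F2" for a b
    using A.m_closed that by (simp add: AutoGroup_simps)
  have inner_apply: "inner_by g w = foldr push (foldr push g w) (inv_word g)"
    if "g \<in> carrier F2" "w \<in> carrier F2" for g w
    using that by (simp add: inner_by_def inv_free_group free_group_simps)
  have "baut Sig1 = inner_by gen_x \<otimes>\<^bsub>AutoGroup F2\<^esub> baut Sig3"
    by (rule auto_F2_eqI)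
      (simp_all add: mult_closed braid_auto_in_auto[of Sig1, simplified] braid_auto_in_auto[of Sig3, simplified] inner_by_auto AutoGroup_mult_apply inner_apply word_calc)
  then show x: "inner_by gen_x = A.embed gen_x"
    using inner_cl[of gen_x] A.gen_closed[of Sig1] A.gen_closed[of Sig3]
    by (simp add: A.embed_gens A.inv_solve_right del: A.gen_closed braid_auto.simps)
  have "baut Sig2 \<otimes>\<^bsub>AutoGroup F2\<^esub> inner_by gen_x = inner_by gen_y \<otimes>\<^bsub>AutoGroup F2\<^esub> baut Sig2"
    by (rule auto_F2_eqI)
      (simp_all add: mult_closed braid_auto_in_auto[of Sig2, simplified] inner_by_auto AutoGroup_mult_apply inner_apply word_calc)
  then have "inner_by gen_y = baut Sig2 \<otimes>\<^bsub>AutoGroup F2\<^esub> inner_by gen_x \<otimes>\<^bsub>AutoGroup F2\<^esub> inv\<^bsub>AutoGroup F2\<^esub> baut Sig2"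
    using inner_cl[of gen_x] inner_cl[of gen_y] A.gen_closed[of Sig2]
    by (simp add: A.inv_solve_right del: A.gen_closed braid_auto.simps)
  then show "inner_by gen_y = A.embed gen_y"
    unfolding x A.embed_gens .
qed

text \<open>In the product of \<open>G\<close> and the automorphism group, \<open>w\<close> goes to
  \<open>embed w\<close> paired with \<open>inner_by w\<close>. If the first component is trivial,
  \<open>braid_kernel_trivial\<close> makes the second trivial too, and the centre of
  \<open>F2\<close> is trivial.\<close>

lemma (in braid4) embed_inj:
  assumes faithful: "\<And>u v. eval_word u = eval_word v \<Longrightarrow> u \<sim> v"
  shows "inj_on embed (carrier F2)"
proof -
  interpret A: braid4 "AutoGroup F2" baut by (rule braid4_AutoGroup)
  interpret F: group F2 by (rule group_free_group)
  let ?\<Gamma> = "G \<times>\<times> AutoGroup F2" and ?\<tau> = "\<lambda>i. (\<sigma> i, baut i)"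
  interpret \<Gamma>: group ?\<Gamma> by (rule DirProd_group[OF is_group A.is_group])
  interpret \<Gamma>: braid4 ?\<Gamma> ?\<tau>
  proof
    fix i j
    show "?\<tau> i \<in> carrier ?\<Gamma>" using A.gen_closed by simp
    show "?\<tau> i \<otimes>\<^bsub>?\<Gamma>\<^esub> ?\<tau> j \<otimes>\<^bsub>?\<Gamma>\<^esub> ?\<tau> i = ?\<tau> j \<otimes>\<^bsub>?\<Gamma>\<^esub> ?\<tau> i \<otimes>\<^bsub>?\<Gamma>\<^esub> ?\<tau> j" if "adj i j"
      using gen_adj[OF that] A.gen_adj[OF that] by simp
    show "?\<tau> i \<otimes>\<^bsub>?\<Gamma>\<^esub> ?\<tau> j = ?\<tau> j \<otimes>\<^bsub>?\<Gamma>\<^esub> ?\<tau> i" if "\<not> adj i j"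
      using gen_far[OF that] A.gen_far[OF that] by simp
  qed
  have fst_hom: "fst \<in> hom ?\<Gamma> G" and snd_hom: "snd \<in> hom ?\<Gamma> (AutoGroup F2)"
    by (auto simp: hom_def)
  have inv_pair: "inv\<^bsub>?\<Gamma>\<^esub> (a, b) = (inv a, inv\<^bsub>AutoGroup F2\<^esub> b)"
    if "a \<in> carrier G" "b \<in> carrier (AutoGroup F2)" for a b
    by (rule inv_DirProd[OF is_group A.is_group that])
  have gens: "\<Gamma>.embed gen_x = (embed gen_x, A.embed gen_x)" "\<Gamma>.embed gen_y = (embed gen_y, A.embed gen_y)"
    by (simp_all add: \<Gamma>.embed_gens embed_gens A.embed_gens inv_pair del: braid_auto.simps)
  have fst: "fst (\<Gamma>.embed w) = embed w" if "w \<in> carrier F2" for w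
    using hom_F2_eqI[OF is_group Group.hom_compose[OF \<Gamma>.embed_hom fst_hom] embed_hom _ _ that] gens by simp
  have snd: "snd (\<Gamma>.embed w) = inner_by w" if "w \<in> carrier F2" for w
    using hom_F2_eqI[OF A.is_group Group.hom_compose[OF \<Gamma>.embed_hom snd_hom] inner_by_hom _ _ that]
      gens inner_by_gens by simp
  have "w = []" if w: "w \<in> carrier F2" "embed w = \<one>" for w
  proof -
    have "\<Gamma>.embed w = \<one>\<^bsub>?\<Gamma>\<^esub>"
      by (rule braid_kernel_trivial[OF \<Gamma>.braid4_axioms braid4_axioms fst_hom _ faithful \<Gamma>.embed_in_generate])
        (use w fst in simp_all)
    then have "inner_by w = \<one>\<^bsub>AutoGroup F2\<^esub>" using snd[OF w(1)] by simp
    then show "w = []" by (rule inner_by_eq_one[OF w(1)])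
  qed
  then show ?thesis
    using group_hom.inj_iff_trivial_ker[OF group_hom.intro[OF group_free_group is_group group_hom_axioms.intro[OF embed_hom]]]
    using F.one_closed by (auto simp: kernel_def free_group_simps hom_one[OF embed_hom F.is_group is_group, simplified free_group_simps])
qed

section \<open>Linearity of the holomorph\<close>

lemma linear_sandwich:
  fixes A B :: "real ^ 'n ^ 'n"
  shows "linear (\<lambda>X. A ** X ** B)"
proof (rule linearI)
  have add: "(X + Y) ** B = X ** B + Y ** B" for X Y :: "real ^ 'n ^ 'n"
    by (simp add: matrix_eq matrix_vector_mult_add_rdistrib flip: matrix_vector_mul_assoc)
  show "A ** (X + Y) ** B = A ** X ** B + A ** Y ** B" for X Y
    by (simp add: matrix_add_ldistrib add)
  show "A ** (c *\<^sub>R X) ** B = c *\<^sub>R (A ** X ** B)" for c X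
    by (simp add: matrix_scalar_ac flip: scalar_matrix_assoc)
qed

lemma linear_map_pair:
  assumes "linear f" "linear g"
  shows "linear (\<lambda>p. (f (fst p), g (snd p)))"
  using assms by (intro linearI) (simp_all add: linear_add linear_scale)

lemma auto_F2_nielsen_pair:
  assumes \<phi>: "\<phi> \<in> auto F2"
  shows "nielsen_pair (\<phi> gen_x) (\<phi> gen_y)" "\<And>w. w \<in> carrier F2 \<Longrightarrow> \<phi> w = endo (\<phi> gen_x) (\<phi> gen_y) w"
proof -
  interpret F: group F2 by (rule group_free_group)
  have hom: "\<phi> \<in> hom F2 F2" and onto: "\<phi> ` carrier F2 = carrier F2"
    using \<phi> by (auto simp: auto_def Bij_def bij_betw_def)
  have cl: "\<phi> gen_x \<in> carrier F2" "\<phi> gen_y \<in> carrier F2"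
    using hom by (simp_all add: hom_in_carrier)
  show eq: "\<phi> w = endo (\<phi> gen_x) (\<phi> gen_y) w" if "w \<in> carrier F2" for w
    by (rule hom_F2_eqI[OF group_free_group hom endo_hom[OF cl] _ _ that]) (simp_all add: cl)
  let ?f = "\<lambda>i::nat. if i = 0 then \<phi> gen_x else \<phi> gen_y"
  have f: "?f \<in> {..<2} \<rightarrow> carrier F2" using cl by simp
  have "endo (\<phi> gen_x) (\<phi> gen_y) w \<in> generate F2 {\<phi> gen_x, \<phi> gen_y}" if "w \<in> carrier F2" for w
    using F.word_val_in_generate[OF f carrier_free_groupD(2)[OF that]]
      F.mono_generate[of "?f ` {..<2}" "{\<phi> gen_x, \<phi> gen_y}"] unfolding endo_def by auto
  then have "\<phi> ` carrier F2 \<subseteq> generate F2 {\<phi> gen_x, \<phi> gen_y}"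
    by (auto simp del: endo_gen simp flip: eq)
  then have "carrier F2 \<subseteq> generate F2 {\<phi> gen_x, \<phi> gen_y}" using onto by simp
  then have "generate F2 {\<phi> gen_x, \<phi> gen_y} = carrier F2"
    using F.generate_incl[of "{\<phi> gen_x, \<phi> gen_y}"] cl by auto
  then show "nielsen_pair (\<phi> gen_x) (\<phi> gen_y)" by (rule nielsen_pair_if_generates[OF cl])
qed

text \<open>The moves \<open>rotate\<close>, \<open>shear\<close> and \<open>reflect\<close>
  precompose \<open>endo u v\<close> with a fixed automorphism, so the linear maps compose; for
  \<open>reflect\<close> the new factor is the swap of the coordinates. The move
  \<open>conjugate\<close> postcomposes with an inner automorphism, which multiplies both
  coordinates by matrices on either side.\<close>

lemma nielsen_pair_linear:
  assumes "braid4 (matrix_group :: (real ^ 'n ^ 'n) monoid) \<sigma>" and "nielsen_pair u v"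
  defines "F \<equiv> \<lambda>h. (braid4.embed matrix_group \<sigma> h, braid4.embed matrix_group \<sigma> (invert_x h))"
  shows "u \<in> carrier F2 \<and> v \<in> carrier F2 \<and> (\<exists>L. linear L \<and> (\<forall>h \<in> carrier F2. F (endo u v h) = L (F h)))"
  using assms(2)
proof induction
  interpret B: braid4 "matrix_group :: (real ^ 'n ^ 'n) monoid" \<sigma> by fact
  interpret F2: group F2 by (rule group_free_group)
  have red: "reduced w" if "w \<in> carrier F2" for w
    using that by (rule carrier_free_groupD)
  have inv_x_closed: "invert_x h \<in> carrier F2" if "h \<in> carrier F2" for h
    using that by (simp add: endo_closed)
  have compose: "\<exists>L. linear L \<and> (\<forall>h \<in> carrier F2. F (endo (endo u v a) (endo u v b) h) = L (F h))"
    if uv: "u \<in> carrier F2" "v \<in> carrier F2" and ab: "a \<in> carrier F2" "b \<in> carrier F2"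
      and L: "\<exists>L. linear L \<and> (\<forall>h \<in> carrier F2. F (endo u v h) = L (F h))"
      and M: "\<exists>L. linear L \<and> (\<forall>h \<in> carrier F2. F (endo a b h) = L (F h))" for u v a b
  proof -
    obtain L M where L: "linear L" "\<forall>h \<in> carrier F2. F (endo u v h) = L (F h)"
      and M: "linear M" "\<forall>h \<in> carrier F2. F (endo a b h) = M (F h)"
      using L M by blast
    have "F (endo (endo u v a) (endo u v b) h) = (L \<circ> M) (F h)" if "h \<in> carrier F2" for h
      using L(2) M(2) that by (simp add: endo_closed[OF ab] flip: endo_endo[OF uv ab that])
    then show ?thesis using linear_compose[OF M(1) L(1)] by blast
  qed
  have rotate: "\<exists>L. linear L \<and> (\<forall>h \<in> carrier F2. F (endo gen_y inv_x h) = L (F h))"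
    using B.embed_rotate B.embed_invert_x_rotate unfolding F_def
    by (intro exI[of _ "\<lambda>p. (B.rotation ** fst p ** inv\<^bsub>matrix_group\<^esub> B.rotation,
        inv\<^bsub>matrix_group\<^esub> B.rotation ** snd p ** inv\<^bsub>matrix_group\<^esub> (inv\<^bsub>matrix_group\<^esub> B.rotation))"]
        conjI linear_map_pair linear_sandwich) simp
  have shear: "\<exists>L. linear L \<and> (\<forall>h \<in> carrier F2. F (endo gen_x [(Suc 0, True), (0, False)] h) = L (F h))"
    using B.embed_shear B.embed_invert_x_shear unfolding F_def
    by (intro exI[of _ "\<lambda>p. (\<sigma> Sig1 ** fst p ** inv\<^bsub>matrix_group\<^esub> \<sigma> Sig1,
        inv\<^bsub>matrix_group\<^esub> \<sigma> Sig1 ** snd p ** inv\<^bsub>matrix_group\<^esub> (inv\<^bsub>matrix_group\<^esub> \<sigma> Sig1))"]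
        conjI linear_map_pair linear_sandwich) simp
  have invert_x_invert_x: "invert_x (invert_x h) = h" if "h \<in> carrier F2" for h
    using that endo_basis[OF that] by (simp add: endo_endo endo_Cons inv_word_Cons flip_def)
  have "linear (\<lambda>p :: (real ^ 'n ^ 'n) \<times> (real ^ 'n ^ 'n). (snd p, fst p))"
    by (rule linearI) simp_all
  then have reflect: "\<exists>L. linear L \<and> (\<forall>h \<in> carrier F2. F (invert_x h) = L (F h))"
    unfolding F_def by (intro exI[of _ "\<lambda>p. (snd p, fst p)"] conjI) (simp_all add: invert_x_invert_x)
  {
    case basis
    have "\<exists>L. linear L \<and> (\<forall>h \<in> carrier F2. F (endo gen_x gen_y h) = L (F h))"
      using linear_id by (intro exI[of _ id]) (simp add: endo_basis)
    then show ?case by simp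
  next
    case (rotate u v)
    then show ?case
      using compose[of u v gen_y inv_x] \<open>\<exists>L. linear L \<and> (\<forall>h \<in> carrier F2. F (endo gen_y inv_x h) = L (F h))\<close>
      by (simp add: inv_word_closed endo_Cons foldr_push_Nil red reduced_inv_word)
  next
    case (shear u v)
    then have "endo u v [(Suc 0, True), (0, False)] = foldr push v (inv_word u)"
      by (simp add: endo_Cons foldr_push_Nil red reduced_inv_word)
    moreover have "foldr push v (inv_word u) \<in> carrier F2"
      using shear F2.m_closed[of v "inv_word u"] by (simp add: free_group_simps inv_word_closed)
    ultimately show ?case
      using compose[of u v gen_x "[(Suc 0, True), (0, False)]"] shear.IH
        \<open>\<exists>L. linear L \<and> (\<forall>h \<in> carrier F2. F (endo gen_x [(Suc 0, True), (0, False)] h) = L (F h))\<close>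
      by simp
  next
    case (reflect u v)
    then have "endo u v inv_x = inv_word u"
      by (simp add: endo_Cons foldr_push_Nil red reduced_inv_word)
    then show ?case
      using compose[of u v inv_x gen_y] reflect.IH
        \<open>\<exists>L. linear L \<and> (\<forall>h \<in> carrier F2. F (invert_x h) = L (F h))\<close>
      by (simp add: inv_word_closed)
  next
    case (conjugate u v g)
    note g = conjugate.hyps(2)
    have uv: "u \<in> carrier F2" "v \<in> carrier F2" using conjugate.IH by auto
    obtain L where L: "linear L" "\<forall>h \<in> carrier F2. F (endo u v h) = L (F h)" using conjugate.IH by blast
    let ?c = "\<lambda>w. foldr push (foldr push g w) (inv_word g)"
    have c: "?c w = g \<otimes>\<^bsub>F2\<^esub> w \<otimes>\<^bsub>F2\<^esub> inv\<^bsub>F2\<^esub> g" for w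
      using g by (simp add: free_group_simps inv_free_group)
    have cl: "?c u \<in> carrier F2" "?c v \<in> carrier F2"
      using uv g by (simp_all only: c) simp_all
    have endo_c: "endo (?c u) (?c v) h = ?c (endo u v h)" if "h \<in> carrier F2" for h
      unfolding c
    proof (rule hom_F2_eqI[OF group_free_group _ F2.conjugation_hom[OF endo_hom[OF uv] g] _ _ that])
      show "endo (g \<otimes>\<^bsub>F2\<^esub> u \<otimes>\<^bsub>F2\<^esub> inv\<^bsub>F2\<^esub> g) (g \<otimes>\<^bsub>F2\<^esub> v \<otimes>\<^bsub>F2\<^esub> inv\<^bsub>F2\<^esub> g) \<in> hom F2 F2"
        using uv g by (intro endo_hom) simp_all
    qed (use uv g in simp_all)
    have embed_c: "B.embed (?c w) = B.embed g ** B.embed w ** B.embed (inv_word g)" if "w \<in> carrier F2" for w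
      using g that F2.m_closed[of g w] by (simp add: B.embed_mult inv_word_closed free_group_simps)
    have inv_x_c: "invert_x (?c w) = foldr push (foldr push (invert_x g) (invert_x w)) (invert_x (inv_word g))"
      if "w \<in> carrier F2" for w
      using hom_mult[OF B.invert_x_hom] g that F2.m_closed[of g w] by (simp add: inv_word_closed free_group_simps)
    let ?M = "\<lambda>p. (B.embed g ** fst p ** B.embed (inv_word g),
      B.embed (invert_x g) ** snd p ** B.embed (invert_x (inv_word g)))"
    have "F (endo (?c u) (?c v) h) = (?M \<circ> L) (F h)" if h: "h \<in> carrier F2" for h
    proof -
      have w: "endo u v h \<in> carrier F2" using uv h by (simp add: endo_closed)
      have "B.embed (invert_x (?c (endo u v h)))
          = B.embed (invert_x g) ** B.embed (invert_x (endo u v h)) ** B.embed (invert_x (inv_word g))"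
        unfolding inv_x_c[OF w]
        using inv_x_closed g w F2.m_closed[of "invert_x g" "invert_x (endo u v h)"]
        by (simp add: B.embed_mult inv_word_closed free_group_simps)
      then have "F (?c (endo u v h)) = ?M (F (endo u v h))"
        by (simp add: F_def embed_c[OF w])
      then show ?thesis using L(2) h by (simp add: endo_c)
    qed
    moreover have "linear (?M \<circ> L)"
      by (rule linear_compose[OF L(1) linear_map_pair[OF linear_sandwich linear_sandwich]])
    ultimately show ?case using cl by blast
  }
qed

theorem corollary3:
  shows "\<exists>(K :: complex ring) (d :: nat) (\<rho> :: (nat letter list \<Rightarrow> nat letter list) \<times> nat letter list \<Rightarrow> complex mat).
    field K \<and> char_zero K \<and> d > 0 \<and> \<rho> \<in> mon (holomorph F2) (GL d K)"
proof -
  obtain s :: real where s: "\<forall>p::int poly. poly (map_poly of_int p) s = 0 \<longrightarrow> p = 0"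
    using ex_transcendental by blast
  have "s \<noteq> 0" using s[rule_format, of "[:0, 1:]"] by (auto simp: map_poly_pCons)
  interpret B: braid4 matrix_group "lk_mat s" by (rule braid4_lk[OF \<open>s \<noteq> 0\<close>])
  interpret F2: group F2 by (rule group_free_group)
  have inj: "inj_on B.embed (carrier F2)"
    using B.embed_inj lk_mat_faithful[OF s \<open>s \<noteq> 0\<close>] by blast
  define F where "F h = (B.embed h, B.embed (invert_x h))" for h
  let ?act = "\<lambda>(\<phi>, g) h. g \<otimes>\<^bsub>F2\<^esub> \<phi> h"
  have hol: "carrier (holomorph F2) = auto F2 \<times> carrier F2" "\<one>\<^bsub>holomorph F2\<^esub> = (\<lambda>w \<in> carrier F2. w, [])"
    "(\<phi>, g) \<otimes>\<^bsub>holomorph F2\<^esub> (\<psi>, h) = (\<phi> \<otimes>\<^bsub>AutoGroup F2\<^esub> \<psi>, g \<otimes>\<^bsub>F2\<^esub> \<phi> h)" for \<phi> g \<psi> h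
    by (simp_all add: holomorph_def semidirect_def AutoGroup_simps free_group_simps(2))
  have auto_closed: "\<phi> w \<in> carrier F2" if "\<phi> \<in> auto F2" "w \<in> carrier F2" for \<phi> w
    using that by (auto simp: auto_def dest: hom_in_carrier)
  have auto_mult: "\<phi> (g \<otimes>\<^bsub>F2\<^esub> h) = \<phi> g \<otimes>\<^bsub>F2\<^esub> \<phi> h" if "\<phi> \<in> auto F2" "g \<in> carrier F2" "h \<in> carrier F2" for \<phi> g h
    using that hom_mult[of \<phi> F2 F2] by (simp add: auto_def)
  have auto_one: "\<phi> [] = []" if "\<phi> \<in> auto F2" for \<phi>
    using that hom_one[of \<phi> F2 F2] by (simp add: auto_def F2.is_group free_group_simps(2))
  have Nil: "[] \<in> carrier F2" using F2.one_closed by (simp only: free_group_simps)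
  have r_Nil: "g \<otimes>\<^bsub>F2\<^esub> [] = g" if "g \<in> carrier F2" for g
    using F2.r_one[OF that] by (simp only: free_group_simps(2))
  have "\<exists>d > 0. \<exists>\<rho>. \<rho> \<in> mon (holomorph F2) (GL d complex_ring)"
  proof (rule faithful_representation_of_action[where X = "carrier F2" and act = ?act and f = F])
    show "group (holomorph F2)" by (rule group_holomorph[OF F2.is_group])
    show "inj_on F (carrier F2)" using inj by (auto simp: F_def inj_on_def)
    show "\<exists>x \<in> carrier F2. F x \<noteq> 0"
    proof (rule ccontr)
      assume "\<not> ?thesis"
      then have "B.embed gen_x = B.embed gen_y" by (simp add: F_def zero_prod_def)
      then show False using inj_onD[OF inj, of gen_x gen_y] by simp
    qed
    fix \<gamma> assume "\<gamma> \<in> carrier (holomorph F2)"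
    then obtain \<phi> g where \<gamma>: "\<gamma> = (\<phi>, g)" "\<phi> \<in> auto F2" "g \<in> carrier F2" by (auto simp: hol)
    show "?act \<gamma> h \<in> carrier F2" if "h \<in> carrier F2" for h
      using \<gamma> that auto_closed by simp
    obtain L where L: "linear L"
      "\<forall>h \<in> carrier F2. F (endo (\<phi> gen_x) (\<phi> gen_y) h) = L (F h)"
      using nielsen_pair_linear[OF B.braid4_axioms auto_F2_nielsen_pair(1)[OF \<gamma>(2)]] unfolding F_def by blast
    \<comment> \<open>Left translation by \<open>g\<close> multiplies the coordinates by the
      matrices of \<open>g\<close> and \<open>invert_x g\<close>; the identity factors bring this
      into the form of \<open>linear_sandwich\<close>.\<close>
    let ?M = "\<lambda>p. (B.embed g ** fst p ** Finite_Cartesian_Product.mat 1,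
      B.embed (invert_x g) ** snd p ** Finite_Cartesian_Product.mat 1)"
    have "F (?act \<gamma> h) = (?M \<circ> L) (F h)" if h: "h \<in> carrier F2" for h
    proof -
      have w: "\<phi> h \<in> carrier F2" using auto_closed[OF \<gamma>(2) h] .
      have "F (g \<otimes>\<^bsub>F2\<^esub> \<phi> h) = ?M (F (\<phi> h))"
        using hom_mult[OF B.embed_hom \<gamma>(3) w] hom_mult[OF B.invert_x_hom \<gamma>(3) w]
          hom_mult[OF B.embed_hom hom_in_carrier[OF B.invert_x_hom \<gamma>(3)] hom_in_carrier[OF B.invert_x_hom w]]
        by (simp add: F_def)
      then show ?thesis using L(2) h auto_F2_nielsen_pair(2)[OF \<gamma>(2) h] \<gamma>(1) by simp
    qed
    moreover have "linear (?M \<circ> L)"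
      by (rule linear_compose[OF L(1) linear_map_pair[OF linear_sandwich linear_sandwich]])
    ultimately show "\<exists>L. linear L \<and> (\<forall>x \<in> carrier F2. F (?act \<gamma> x) = L (F x))" by blast
    fix \<delta> assume "\<delta> \<in> carrier (holomorph F2)"
    then obtain \<psi> k where \<delta>: "\<delta> = (\<psi>, k)" "\<psi> \<in> auto F2" "k \<in> carrier F2" by (auto simp: hol)
    show "?act (\<gamma> \<otimes>\<^bsub>holomorph F2\<^esub> \<delta>) h = ?act \<gamma> (?act \<delta> h)" if "h \<in> carrier F2" for h
      using \<gamma> \<delta> that auto_closed by (simp add: hol AutoGroup_mult_apply auto_mult F2.m_assoc)
    assume eq: "\<And>x. x \<in> carrier F2 \<Longrightarrow> ?act \<gamma> x = ?act \<delta> x"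
    \<comment> \<open>The translation part is the image of the neutral element.\<close>
    have "g = k" using eq[OF Nil] \<gamma> \<delta> by (simp add: auto_one r_Nil)
    moreover have "\<phi> = \<psi>"
      using eq[of gen_x] eq[of gen_y] \<gamma> \<delta> \<open>g = k\<close> auto_closed by (intro auto_F2_eqI) simp_all
    ultimately show "\<gamma> = \<delta>" using \<gamma> \<delta> by simp
  next
    show "?act \<one>\<^bsub>holomorph F2\<^esub> x = x" if "x \<in> carrier F2" for x
      using that F2.l_one[OF that] by (simp add: hol free_group_simps)
  qed
  then show ?thesis using field_complex_ring char_zero_complex_ring by blast
qed

end
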